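(* For every integer $k\ge 4$, $\tilde{r}(P_3,P_3,C_{4k-2}) \le 6k-2$.
   Context: $P_m$ denotes the path and $C_m$ the cycle on $m$ vertices. The three-color online Ramsey game for graphs $G_1,G_2,G_3$ is played by Builder and Painter on an infinite vertex set with initially no edges. In each round Builder draws an edge between two currently nonadjacent vertices, and Painter immediately colors it red, blue or green. Builder wins once the colored graph contains a red copy of $G_1$, a blue copy of $G_2$, or a green copy of $G_3$. The online Ramsey number $\tilde{r}(G_1,G_2,G_3)$ is the minimum number of rounds within which Builder can guarantee a win against every strategy of Painter. *)

theory Defs
  imports Main "HOL-Library.Extended_Nat"
begin

type_synonym 'a graph = "'a set \<times> 'a set set"

definition path_graph :: "nat \<Rightarrow> nat graph" where
  "path_graph m = ({..<m}, {{i, Suc i} | i. Suc i < m})"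

text \<open>This is the simple cycle on \<open>m\<close> vertices only for \<open>m \<ge> 3\<close>.\<close>

definition cycle_graph :: "nat \<Rightarrow> nat graph" where
  "cycle_graph m = ({..<m}, {{i, Suc i mod m} | i. i < m})"

datatype colour = Red | Blue | Green

text \<open>The infinite vertex set of the board is \<^typ>\<open>nat\<close>. A history lists the coloured edges
  drawn so far, most recent first.\<close>

type_synonym history = "(nat set \<times> colour) list"

definition colour_class :: "colour \<Rightarrow> history \<Rightarrow> nat set set" where
  "colour_class c h = {e. (e, c) \<in> set h}"

text \<open>Copies are subgraphs, not necessarily induced.\<close>

definition contains_copy :: "nat set set \<Rightarrow> 'a graph \<Rightarrow> bool" where
  "contains_copy E G \<longleftrightarrow> (\<exists>f. inj_on f (fst G) \<and> (\<forall>e \<in> snd G. f ` e \<in> E))"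

definition builder_won :: "'a graph \<Rightarrow> 'b graph \<Rightarrow> 'c graph \<Rightarrow> history \<Rightarrow> bool" where
  "builder_won G1 G2 G3 h \<longleftrightarrow>
     contains_copy (colour_class Red h) G1 \<or>
     contains_copy (colour_class Blue h) G2 \<or>
     contains_copy (colour_class Green h) G3"

type_synonym builder = "history \<Rightarrow> nat set"
type_synonym painter = "history \<Rightarrow> nat set \<Rightarrow> colour"

text \<open>Legality is demanded at every history, reachable or not. This is no restriction on Builder:
  a history is finite, so a legal move always exists.\<close>

definition legal_builder :: "builder \<Rightarrow> bool" where
  "legal_builder b \<longleftrightarrow> (\<forall>h. (\<exists>u v. u \<noteq> v \<and> b h = {u, v}) \<and> b h \<notin> fst ` set h)"

primrec play :: "builder \<Rightarrow> painter \<Rightarrow> nat \<Rightarrow> history" where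
  "play b p 0 = []"
| "play b p (Suc n) = (let h = play b p n; e = b h in (e, p h e) # h)"

definition builder_wins_within :: "'a graph \<Rightarrow> 'b graph \<Rightarrow> 'c graph \<Rightarrow> nat \<Rightarrow> bool" where
  "builder_wins_within G1 G2 G3 n \<longleftrightarrow>
     (\<exists>b. legal_builder b \<and> (\<forall>p. \<exists>j\<le>n. builder_won G1 G2 G3 (play b p j)))"

text \<open>The minimum is taken in \<^typ>\<open>enat\<close>, so that it is \<open>\<infinity>\<close> if Builder cannot force a win in
  any bounded number of rounds.\<close>

definition online_ramsey :: "'a graph \<Rightarrow> 'b graph \<Rightarrow> 'c graph \<Rightarrow> enat" where
  "online_ramsey G1 G2 G3 = Inf {enat n | n. builder_wins_within G1 G2 G3 n}"

end

theory Submission imports Defs begin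

text \<open>Write \<open>L = 4 * k - 2\<close>. A vertex is saturated once it meets a red and a blue edge. Painter has to
  colour every further edge at a saturated vertex green, and likewise every edge between an end of a red
  edge and an end of a blue edge. Builder may waste \<open>L div 2 + 1\<close> edges, namely about one for every two
  edges of the cycle. This is just enough: an edge that is coloured red or blue colours two vertices, and
  each saturated vertex yields two forced green edges of the cycle, while an edge that Painter colours
  green for free extends a green path.

  Builder first aims at a reserve, namely a saturated vertex (or a green path with saturated ends) away
  from the main green path. The reserve absorbs the problem of closing the cycle at exactly the right
  length. With a reserve, the main path is extended from one end; whenever an end has been coloured, the
  next edge at it either extends the path or saturates the end. As long as Painter prevents a reserve by
  colouring green, the main path grows with so little waste that the cycle can be closed without one.\<close>

section \<open>Positions of the game\<close>

definition incident :: "history \<Rightarrow> colour \<Rightarrow> nat \<Rightarrow> bool" where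
  "incident h c v \<longleftrightarrow> (\<exists>e. (e, c) \<in> set h \<and> v \<in> e)"

definition drawn :: "history \<Rightarrow> nat \<Rightarrow> nat \<Rightarrow> bool" where
  "drawn h u v \<longleftrightarrow> {u, v} \<in> fst ` set h"

definition green :: "history \<Rightarrow> nat \<Rightarrow> nat \<Rightarrow> bool" where
  "green h u v \<longleftrightarrow> ({u, v}, Green) \<in> set h"

definition touched :: "history \<Rightarrow> nat set" where
  "touched h = \<Union> (fst ` set h)"

definition saturated :: "history \<Rightarrow> nat \<Rightarrow> bool" where
  "saturated h v \<longleftrightarrow> (\<forall>c. c \<noteq> Green \<longrightarrow> incident h c v)"

definition forced :: "history \<Rightarrow> nat \<Rightarrow> nat \<Rightarrow> bool" where
  "forced h u v \<longleftrightarrow> (\<forall>c. c \<noteq> Green \<longrightarrow> incident h c u \<or> incident h c v)"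

lemma incident_Cons [simp]:
  "incident ((e, d) # h) c v \<longleftrightarrow> (d = c \<and> v \<in> e) \<or> incident h c v"
  by (auto simp: incident_def)

lemma drawn_Cons [simp]:
  "drawn (({x, y}, d) # h) u v \<longleftrightarrow> (u = x \<and> v = y) \<or> (u = y \<and> v = x) \<or> drawn h u v"
  by (auto simp: drawn_def doubleton_eq_iff)

lemma green_Cons [simp]:
  "green (({x, y}, d) # h) u v \<longleftrightarrow>
    (d = Green \<and> ((u = x \<and> v = y) \<or> (u = y \<and> v = x))) \<or> green h u v"
  by (auto simp: green_def doubleton_eq_iff)

lemma touched_Cons [simp]: "touched ((e, d) # h) = e \<union> touched h"
  by (auto simp: touched_def)

lemma empty_history [simp]:
  "\<not> incident [] c v" "\<not> drawn [] u v" "\<not> green [] u v" "touched [] = {}"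
  by (auto simp: incident_def drawn_def green_def touched_def)

lemma saturated_Cons [simp]: "saturated h v \<Longrightarrow> saturated (e # h) v"
  by (cases e) (auto simp: saturated_def)

lemma untouched [simp]:
  assumes "v \<notin> touched h"
  shows "\<not> incident h c v" "\<not> drawn h u v" "\<not> drawn h v u"
proof -
  have "v \<notin> e" if "e \<in> fst ` set h" for e
    using assms that by (auto simp: touched_def)
  then show "\<not> incident h c v" "\<not> drawn h u v" "\<not> drawn h v u"
    by (fastforce simp: incident_def drawn_def)+
qed

lemma drawn_commute: "drawn h u v \<longleftrightarrow> drawn h v u"
  by (simp add: drawn_def insert_commute)

lemma green_commute: "green h u v \<longleftrightarrow> green h v u"
  by (simp add: green_def insert_commute)

lemma green_touched: "green h u v \<Longrightarrow> u \<in> touched h \<and> v \<in> touched h"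
  unfolding green_def touched_def by (auto intro!: bexI[of _ "({u, v}, Green)"])

lemma saturatedI:
  assumes "incident h c v" "incident h d v" "c \<noteq> Green" "d \<noteq> Green" "c \<noteq> d"
  shows "saturated h v"
  unfolding saturated_def
proof (intro allI impI)
  fix b :: colour assume "b \<noteq> Green"
  with assms show "incident h b v" by (cases b; cases c; cases d) auto
qed

lemma saturated_forced [simp]: "saturated h u \<Longrightarrow> forced h u v" "saturated h v \<Longrightarrow> forced h u v"
  by (auto simp: saturated_def forced_def)

lemma forced_Cons [simp]: "forced h u v \<Longrightarrow> forced (e # h) u v"
  by (cases e) (auto simp: forced_def)

lemma opposite_forced:
  assumes "incident h c u" "incident h d v" "c \<noteq> Green" "d \<noteq> Green" "c \<noteq> d"
  shows "forced h u v"
  unfolding forced_def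
proof (intro allI impI)
  fix b :: colour assume "b \<noteq> Green"
  with assms show "incident h b u \<or> incident h b v" by (cases b; cases c; cases d) auto
qed

section \<open>Boards, fresh vertices and green paths\<close>

lemma finite_touched: "\<forall>e \<in> fst ` set h. finite e \<Longrightarrow> finite (touched h)"
  by (auto simp: touched_def)

text \<open>Positions are arbitrary lists, reachable or not, so degenerate edges have to be ruled
  out separately; \<open>won_monochromatic_P3\<close> needs a second end of each coloured
  edge.\<close>

definition board :: "history \<Rightarrow> bool" where
  "board h \<longleftrightarrow> (\<forall>e \<in> fst ` set h. \<exists>u v. u \<noteq> v \<and> e = {u, v})"

lemma board_simps [simp]: "board []" "board (({u, v}, c) # h) \<longleftrightarrow> u \<noteq> v \<and> board h"
  by (auto simp: board_def doubleton_eq_iff)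

text \<open>Only finitely many vertices have been touched. Five is the largest number of new
  vertices that a single argument below takes from here at once.\<close>

lemma fresh_vertices:
  assumes "board h"
  obtains a b c d e where "distinct [a, b, c, d, e]"
    "a \<notin> touched h" "b \<notin> touched h" "c \<notin> touched h" "d \<notin> touched h" "e \<notin> touched h"
proof -
  have "finite (touched h)"
    using assms by (intro finite_touched) (auto simp: board_def)
  then have "infinite (- touched h)" by (simp add: Compl_eq_Diff_UNIV)
  then obtain S where S: "S \<subseteq> - touched h" "finite S" "card S = 5"
    by (metis infinite_arbitrarily_large)
  then obtain xs where xs: "set xs = S" "distinct xs" "length xs = 5"
    by (metis finite_distinct_list distinct_card)
  then obtain a b c d e where "xs = [a, b, c, d, e]"
    by (auto simp: numeral_eq_Suc length_Suc_conv)
  with xs S that show thesis by auto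
qed

text \<open>One-vertex paths occur as reserves consisting of a single saturated vertex. For them the
  clause \<open>set P \<subseteq> touched h\<close> keeps untouched vertices off the path.\<close>

definition gpath :: "history \<Rightarrow> nat \<Rightarrow> nat list \<Rightarrow> nat \<Rightarrow> bool" where
  "gpath h u P v \<longleftrightarrow> P \<noteq> [] \<and> hd P = u \<and> last P = v \<and> distinct P \<and> set P \<subseteq> touched h \<and>
     successively (green h) P"

lemma gpath_mono:
  assumes "gpath h u P v" "set h \<subseteq> set h'"
  shows "gpath h' u P v"
proof -
  have "touched h \<subseteq> touched h'" "\<And>a b. green h a b \<Longrightarrow> green h' a b"
    using assms(2) by (auto simp: touched_def green_def)
  then show ?thesis
    using assms(1) unfolding gpath_def by (auto intro: successively_mono)
qed

lemma gpath_weaken [simp]: "gpath h u P v \<Longrightarrow> gpath (e # h) u P v"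
  by (rule gpath_mono) auto

lemma gpath_single: "x \<in> touched h \<Longrightarrow> gpath h x [x] x"
  by (simp add: gpath_def)

lemma gpath_Cons:
  assumes "green h x u" "gpath h u P v" "x \<notin> set P"
  shows "gpath h x (x # P) v"
  using assms green_touched[OF assms(1)] by (cases P) (auto simp: gpath_def)

lemma gpath_append:
  assumes "gpath h u P v" "gpath h p Q q" "green h v p" "set P \<inter> set Q = {}"
  shows "gpath h u (P @ Q) q"
  using assms by (auto simp: gpath_def successively_append_iff)

lemma gpath_snoc:
  assumes "green h v x" "gpath h u P v" "x \<notin> set P"
  shows "gpath h u (P @ [x]) x"
  using gpath_append[OF assms(2) gpath_single[of x] assms(1)] green_touched[OF assms(1)] assms(3)
  by auto

lemma gpath_snoc2:
  assumes "green h v x" "green h x y" "gpath h u P v" "x \<notin> set P" "y \<notin> set P" "x \<noteq> y"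
  shows "gpath h u (P @ [x, y]) y"
  using gpath_snoc[OF assms(2) gpath_snoc[OF assms(1,3,4)]] assms by auto

lemma gpath_rev: "gpath h u P v \<Longrightarrow> gpath h v (rev P) u"
proof -
  have "(\<lambda>x y. green h y x) = green h" by (simp add: fun_eq_iff green_commute)
  then have "successively (green h) (rev P) \<longleftrightarrow> successively (green h) P"
    by (metis successively_rev)
  then show "gpath h u P v \<Longrightarrow> gpath h v (rev P) u"
    by (auto simp: gpath_def hd_rev last_rev)
qed

lemma gpath_touched:
  assumes "gpath h u P v"
  shows "u \<in> touched h" "v \<in> touched h" "u \<in> set P" "v \<in> set P" "set P \<subseteq> touched h"
  using assms by (auto simp: gpath_def)

section \<open>Winning positions and forced moves\<close>

definition won :: "nat \<Rightarrow> history \<Rightarrow> bool" where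
  "won L h \<longleftrightarrow> builder_won (path_graph 3) (path_graph 3) (cycle_graph L) h"

text \<open>Backward induction on the game tree, with \<open>r\<close> the number of rounds left.
  All case analyses are about positions; strategies as functions appear only in the last
  section.\<close>

primrec wins :: "nat \<Rightarrow> nat \<Rightarrow> history \<Rightarrow> bool" where
  "wins L 0 h \<longleftrightarrow> won L h"
| "wins L (Suc r) h \<longleftrightarrow> won L h \<or>
     (\<exists>u v. u \<noteq> v \<and> \<not> drawn h u v \<and> (\<forall>c. wins L r (({u, v}, c) # h)))"

lemma won_wins: "won L h \<Longrightarrow> wins L r h"
  by (cases r) auto

text \<open>The older edge of colour \<open>c\<close> at \<open>u\<close> has another end
  \<open>w\<close>, and \<open>w \<noteq> v\<close> because the new edge was not drawn before; so
  \<open>v\<close>, \<open>u\<close>, \<open>w\<close> is a monochromatic path.\<close>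

lemma won_monochromatic_P3:
  assumes "board h" "u \<noteq> v" "\<not> drawn h u v" "c \<noteq> Green" "incident h c u"
  shows "won L (({u, v}, c) # h)"
proof -
  obtain e where e: "(e, c) \<in> set h" "u \<in> e"
    using assms(5) by (auto simp: incident_def)
  then obtain w where w: "e = {u, w}" "u \<noteq> w"
    using assms(1) by (fastforce simp: board_def)
  have "w \<noteq> v" using e w assms(3) by (force simp: drawn_def)
  define f where "f = (\<lambda>i::nat. if i = 0 then v else if i = 1 then u else w)"
  have "snd (path_graph 3) = {{0, 1}, {1, 2}}"
    by (auto simp: path_graph_def less_Suc_eq numeral_eq_Suc)
  moreover have "inj_on f (fst (path_graph 3))"
    using \<open>w \<noteq> v\<close> w assms(2) by (auto simp: path_graph_def inj_on_def f_def)
  ultimately have "contains_copy (colour_class c (({u, v}, c) # h)) (path_graph 3)"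
    using e w unfolding contains_copy_def colour_class_def
    by (intro exI[of _ f]) (auto simp: f_def insert_commute)
  then show ?thesis
    using assms(4) by (cases c) (auto simp: won_def builder_won_def)
qed

lemma won_green_cycle:
  assumes "gpath h u P v" "length P = L" "green h v u"
  shows "won L h"
proof -
  have P: "P \<noteq> []" "hd P = u" "last P = v" "distinct P" "successively (green h) P"
    using assms(1) by (auto simp: gpath_def)
  have "inj_on ((!) P) {..<L}"
    using P(4) assms(2) by (auto simp: inj_on_def nth_eq_iff_index_eq)
  moreover have "{P ! i, P ! (Suc i mod L)} \<in> colour_class Green h" if "i < L" for i
  proof (cases "Suc i < L")
    case True
    then have "green h (P ! i) (P ! Suc i)"
      using P(5) assms(2) by (simp add: successively_conv_nth)
    then show ?thesis using True by (simp add: green_def colour_class_def)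
  next
    case False
    then have "Suc i = L" using that by simp
    then have "P ! i = v" "P ! (Suc i mod L) = u"
      using P assms(2) by (auto simp: last_conv_nth hd_conv_nth)
    then show ?thesis using assms(3) by (simp add: green_def colour_class_def)
  qed
  ultimately have "contains_copy (colour_class Green h) (cycle_graph L)"
    unfolding contains_copy_def cycle_graph_def by (intro exI[of _ "(!) P"]) auto
  then show ?thesis by (simp add: won_def builder_won_def)
qed

text \<open>If Painter repeats a red or blue colour already present at an end of the new edge, the
  game is over at once. So Builder has to answer only green and the colours new at both
  ends.\<close>

lemma step:
  assumes "board h" "u \<noteq> v" "\<not> drawn h u v" "0 < r"
    and "wins L (r - 1) (({u, v}, Green) # h)"
    and "\<And>c. c \<noteq> Green \<Longrightarrow> \<not> incident h c u \<Longrightarrow> \<not> incident h c v \<Longrightarrow>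
      wins L (r - 1) (({u, v}, c) # h)"
  shows "wins L r h"
proof -
  have "wins L (r - 1) (({u, v}, c) # h)" for c
  proof (cases "c = Green \<or> (\<not> incident h c u \<and> \<not> incident h c v)")
    case True
    then show ?thesis using assms(5,6) by (cases "c = Green") auto
  next
    case False
    then have "won L (({u, v}, c) # h) \<or> won L (({v, u}, c) # h)"
      using assms(1-3) won_monochromatic_P3[of h u v c L] won_monochromatic_P3[of h v u c L]
      by (auto simp: drawn_commute)
    then show ?thesis by (auto simp: insert_commute intro: won_wins)
  qed
  with assms(2-4) show ?thesis by (cases r) auto
qed

lemma force:
  assumes "forced h u v" "board h" "u \<noteq> v" "\<not> drawn h u v" "0 < r"
    and "wins L (r - 1) (({u, v}, Green) # h)"
  shows "wins L r h"
  using assms by (intro step[of h u v]) (auto simp: forced_def)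

primrec greens :: "(nat \<times> nat) list \<Rightarrow> history \<Rightarrow> history" where
  "greens [] h = h"
| "greens (e # es) h = greens es (({fst e, snd e}, Green) # h)"

primrec forceable :: "(nat \<times> nat) list \<Rightarrow> history \<Rightarrow> bool" where
  "forceable [] h \<longleftrightarrow> True"
| "forceable (e # es) h \<longleftrightarrow> fst e \<noteq> snd e \<and> \<not> drawn h (fst e) (snd e) \<and> forced h (fst e) (snd e) \<and>
     forceable es (({fst e, snd e}, Green) # h)"

text \<open>On a forced edge every answer but green loses at once for Painter. A batch of forced
  edges therefore costs just its length in rounds.\<close>

lemma force_list:
  assumes "board h" "forceable es h" "length es \<le> r" "wins L (r - length es) (greens es h)"
  shows "wins L r h"
  using assms
proof (induction es arbitrary: h r)
  case (Cons e es)
  then have "wins L (r - 1) (({fst e, snd e}, Green) # h)"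
    by - (rule Cons.IH, auto)
  then show ?case using Cons.prems by - (rule force[of h "fst e" "snd e"], auto)
qed simp

lemma close_cycle:
  assumes "gpath h u P v" "length P = L" "forced h v u" "board h" "u \<noteq> v" "\<not> drawn h v u" "0 < r"
  shows "wins L r h"
proof (rule force[of h v u])
  have "gpath (({v, u}, Green) # h) u P v" by (rule gpath_mono[OF assms(1)]) auto
  then show "wins L (r - 1) (({v, u}, Green) # h)"
    using assms(2) by (intro won_wins won_green_cycle[of _ u P v]) auto
qed (use assms in auto)

section \<open>Closing the cycle through a reserve path\<close>

text \<open>The cycle is to consist of the path \<open>P\<close>, the reserve \<open>Q\<close> with saturated ends, and \<open>g\<close> further
  edges. With \<open>r\<close> rounds left, \<open>r - g\<close> more edges may be wasted, so a bound \<open>3 * g \<le> 2 * r + i\<close> says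
  that half an edge may be wasted for every missing one, up to a constant.\<close>

definition reserved :: "nat \<Rightarrow> history \<Rightarrow> nat \<Rightarrow> nat list \<Rightarrow> nat \<Rightarrow> nat \<Rightarrow> nat list \<Rightarrow> nat \<Rightarrow> nat \<Rightarrow> bool"
  where "reserved L h p Q q u P v g \<longleftrightarrow> board h \<and> gpath h p Q q \<and> gpath h u P v \<and> u \<noteq> v \<and>
     set P \<inter> set Q = {} \<and> saturated h p \<and> saturated h q \<and> \<not> drawn h v p \<and> \<not> drawn h q u \<and>
     length P + length Q + g = L + 2 \<and> 2 \<le> g"

lemma reserved_rev: "reserved L h p Q q u P v g \<Longrightarrow> reserved L h q (rev Q) p v (rev P) u g"
  by (auto simp: reserved_def gpath_rev drawn_commute)

text \<open>The two missing edges join \<open>v\<close> to \<open>p\<close> and \<open>q\<close> to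
  \<open>u\<close>. Both are forced because \<open>p\<close> and \<open>q\<close> are saturated, and
  \<open>P @ Q\<close> has exactly \<open>L\<close> vertices.\<close>

lemma reserved_close:
  assumes "reserved L h p Q q u P v 2" "2 \<le> r"
  shows "wins L r h"
proof -
  note R = assms(1)[unfolded reserved_def]
  have uv: "u \<in> set P" "v \<in> set P" "p \<in> set Q" "q \<in> set Q"
    using R by (auto dest: gpath_touched)
  then have ne: "v \<noteq> p" "u \<noteq> q" "u \<noteq> p"
    using R by auto
  let ?h = "({v, p}, Green) # h"
  have "gpath ?h u (P @ Q) q"
    by (rule gpath_append) (use R in \<open>auto intro: gpath_mono\<close>)
  then have "wins L (r - 1) ?h"
    using R uv ne assms(2) by - (rule close_cycle[of _ u "P @ Q" q], auto)
  then show ?thesis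
    using R uv ne assms(2) by - (rule force_list[where es = "[(v, p)]"], auto)
qed

text \<open>Bundles the inequalities from which automation sees that edges to new vertices are
  undrawn and that extended paths stay simple.\<close>

definition apart :: "history \<Rightarrow> nat \<Rightarrow> nat list \<Rightarrow> nat \<Rightarrow> nat list \<Rightarrow> bool" where
  "apart h u P v xs \<longleftrightarrow> distinct xs \<and> u \<notin> set xs \<and> v \<notin> set xs \<and> set xs \<inter> touched h = {} \<and>
     set xs \<inter> set P = {}"

lemma fresh_apart:
  assumes "board h" "gpath h u P v" "gpath h p Q q"
  obtains x y a f w where "apart h u P v [x, y, a, f, w]" "apart h p Q q [x, y, a, f, w]"
proof -
  obtain x y a f w where "distinct [x, y, a, f, w]" "x \<notin> touched h" "y \<notin> touched h"
    "a \<notin> touched h" "f \<notin> touched h" "w \<notin> touched h"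
    using fresh_vertices[OF assms(1)] .
  moreover have "u \<in> set P" "v \<in> set P" "p \<in> set Q" "q \<in> set Q" "set P \<subseteq> touched h" "set Q \<subseteq> touched h"
    using gpath_touched assms(2,3) by auto
  ultimately have "apart h u P v [x, y, a, f, w]" "apart h p Q q [x, y, a, f, w]"
    unfolding apart_def by (simp, blast)+
  then show thesis by (rule that)
qed

lemma reserved_ends:
  assumes "reserved L h p Q q u P v g"
  shows "u \<noteq> p" "u \<noteq> q" "v \<noteq> p" "v \<noteq> q" "gpath h u P v" "gpath h p Q q" "board h"
proof -
  note R = assms[unfolded reserved_def]
  then have "u \<in> set P" "v \<in> set P" "p \<in> set Q" "q \<in> set Q" by (auto dest: gpath_touched)
  with R show "u \<noteq> p" "u \<noteq> q" "v \<noteq> p" "v \<noteq> q" "gpath h u P v" "gpath h p Q q" "board h" by auto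
qed

text \<open>Three claims are proved together: the end \<open>u\<close> is arbitrary, or coloured, or
  saturated with a spare coloured vertex \<open>y\<close> off both paths. These advantages are worth
  0, 1 and 3 half rounds. For equal \<open>g\<close> the first claim rests on the second and the
  second on the third; all other references are to smaller \<open>g\<close>. At \<open>g = 4\<close>
  the first claim asks for one round more than its inequality does.\<close>

lemma reserved_wins:
  assumes "reserved L h p Q q u P v g"
  shows "(3 * g \<le> 2 * r \<and> (g = 4 \<longrightarrow> 7 \<le> r) \<longrightarrow> wins L r h) \<and>
    (incident h c u \<and> c \<noteq> Green \<and> 3 * g \<le> 2 * r + 1 \<longrightarrow> wins L r h) \<and>
    (saturated h u \<and> incident h c y \<and> c \<noteq> Green \<and> y \<notin> set P \<and> y \<notin> set Q \<and> \<not> drawn h q y \<and>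
      3 * g \<le> 2 * r + 3 \<longrightarrow> wins L r h)"
  using assms
proof (induction g arbitrary: h p Q q u P v r c y rule: less_induct)
  case (less g)
  have IH_X: "wins L r h" if "reserved L h p Q q u P v g'" "g' < g"
      "3 * g' \<le> 2 * r" "g' = 4 \<Longrightarrow> 7 \<le> r" for h p Q q u P v g' r
    using less.IH[OF that(2,1)] that(3,4) by blast
  have IH_D: "wins L r h" if "reserved L h p Q q u P v g'" "g' < g" "incident h c u" "c \<noteq> Green"
      "3 * g' \<le> 2 * r + 1" for h p Q q u P v g' r c
    using less.IH[OF that(2,1)] that(3-) by blast
  have IH_R: "wins L r h" if "reserved L h p Q q u P v g'" "g' < g" "saturated h u"
      "incident h c y" "c \<noteq> Green" "y \<notin> set P" "y \<notin> set Q" "\<not> drawn h q y" "3 * g' \<le> 2 * r + 3"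
    for h p Q q u P v g' r c y
    using less.IH[OF that(2,1)] that(3-) by blast

  have sat_end: "wins L r h" if res: "reserved L h p Q q u P v g" and sat: "saturated h u"
    and y: "incident h c y" "c \<noteq> Green" "y \<notin> set P" "y \<notin> set Q" "\<not> drawn h q y"
    and r: "3 * g \<le> 2 * r + 3" for h p Q q u P v r c y
  proof -
    note R = res[unfolded reserved_def, simplified]
    note E = reserved_ends[OF res]
    note PQ = E(5,6)[THEN gpath_mono]
    obtain z x a f w where "apart h u P v [z, x, a, f, w]" "apart h p Q q [z, x, a, f, w]"
      using fresh_apart[OF E(7,5,6)] .
    note F = this[unfolded apart_def, simplified] E(1-4)
    have yz: "y \<noteq> z" "y \<noteq> f" "y \<noteq> u" "y \<noteq> v" "y \<noteq> p" "y \<noteq> q"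
      using y F gpath_touched[of h u P v] gpath_touched[of h p Q q] R by auto
    consider "g = 2" | "g = 3" | "4 \<le> g" using R by linarith
    then show ?thesis
    proof cases
      case 1
      then show ?thesis using reserved_close res r by auto
    next
      case 2
      let ?h = "({q, f}, Green) # ({v, p}, Green) # h"
      have "gpath ?h u (P @ Q @ [f]) f"
        by (intro gpath_append[of _ u P v p] gpath_snoc[of _ q f p Q] PQ) (use F R in auto)
      then have "wins L (r - 1 - 1) ?h"
        using F R 2 r sat by - (rule close_cycle[of _ u "P @ Q @ [f]" f], auto)
      then show ?thesis using F R 2 r
        by - (rule force_list[where es = "[(v, p), (q, f)]"], auto)
    next
      case 3
      have r2: "3 * (g - 2) \<le> 2 * (r - 1 - 1) + 1" "3 * (g - 2) \<le> 2 * (r - 1 - 1 - 1) + 3"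
        using r 3 by linarith+
      \<comment> \<open>Builder tests the spare vertex \<open>y\<close>. If the edge to
        \<open>z\<close> is green, the path grows by two edges in two rounds and ends in the
        coloured \<open>y\<close>. Otherwise \<open>y\<close> is saturated, \<open>z\<close> is the
        new spare vertex, and the forced edges through \<open>f\<close> give two cycle edges in
        three rounds, exactly the budgeted rate.\<close>
      show ?thesis
      proof (rule step[of h y z])
        let ?h = "({z, u}, Green) # ({y, z}, Green) # h"
        have "gpath ?h y (y # z # P) v"
          by (intro gpath_Cons[of _ y z "z # P"] gpath_Cons[of _ z u P] PQ)
            (use F yz y in auto)
        then have "wins L (r - 1 - 1) ?h" using F yz R 3 y r2
          by - (rule IH_D[of _ p Q q y "y # z # P" v "g - 2" c], auto simp: reserved_def)
        then show "wins L (r - 1) (({y, z}, Green) # h)"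
          using F yz R 3 r sat by - (rule force_list[where es = "[(z, u)]"], auto)
      next
        fix d assume d: "d \<noteq> Green" "\<not> incident h d y"
        let ?h = "({f, u}, Green) # ({y, f}, Green) # ({y, z}, d) # h"
        have sy: "saturated (({y, z}, d) # h) y"
          using y d by (intro saturatedI[of _ c y d]) auto
        have "gpath ?h y (y # f # P) v"
          by (intro gpath_Cons[of _ y f "f # P"] gpath_Cons[of _ f u P] PQ)
            (use F yz y in auto)
        then have "wins L (r - 1 - 1 - 1) ?h" using F yz R 3 y r2 sy d
          by - (rule IH_R[of _ p Q q y "y # f # P" v "g - 2" d z], auto simp: reserved_def)
        then show "wins L (r - 1) (({y, z}, d) # h)"
          using F yz R 3 r sat sy by - (rule force_list[where es = "[(y, f), (f, u)]"], auto)
      qed (use F yz R 3 r in auto)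
    qed
  qed

  \<comment> \<open>An endgame for the case \<open>g = 5\<close> of \<open>coloured\<close>. Equal
    colours at both ends save one round, since the second claim would ask for
    \<open>6 \<le> r\<close> here. If the edge from \<open>u\<close> to \<open>w\<close> is not
    green, then \<open>w\<close> and \<open>v\<close> carry different colours and the rest of the
    cycle is forced.\<close>
  have both_coloured: "wins L r h" if res: "reserved L h p Q q u P v 4" and g: "g = 5"
    and c: "incident h c u" "incident h c v" "c \<noteq> Green" and r: "5 \<le> r" for h p Q q u P v r c
  proof -
    note R = res[unfolded reserved_def, simplified]
    note E = reserved_ends[OF res]
    note PQ = E(5,6)[THEN gpath_mono]
    obtain w f x y a where "apart h u P v [w, f, x, y, a]" "apart h p Q q [w, f, x, y, a]"
      using fresh_apart[OF E(7,5,6)] .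
    note F = this[unfolded apart_def, simplified] E(1-4)
    show ?thesis
    proof (rule step[of h u w])
      have "gpath (({u, w}, Green) # h) w (w # P) v"
        by (intro gpath_Cons[of _ w u P] PQ)
          (use F in auto)
      then have "reserved L (({u, w}, Green) # h) p Q q w (w # P) v 3"
        using F R by (auto simp: reserved_def)
      from IH_D[OF reserved_rev[OF this], of c "r - 1"]
      show "wins L (r - 1) (({u, w}, Green) # h)" using g c r by auto
    next
      fix d assume d: "d \<noteq> Green" "\<not> incident h d u"
      let ?h1 = "({u, w}, d) # h"
      let ?h = "({q, f}, Green) # ({w, p}, Green) # ({v, w}, Green) # ?h1"
      have sat: "saturated ?h1 u" using c d by (intro saturatedI[of _ c u d]) auto
      have fo: "forced ?h1 v w" using c d by (intro opposite_forced[of _ c v d]) auto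
      have "gpath ?h u ((P @ [w]) @ Q @ [f]) f"
        by (intro gpath_append[of _ u "P @ [w]" w p] gpath_snoc[of _ q f p Q] gpath_snoc[of _ v w u P] PQ)
          (use F R in auto)
      then have "wins L (r - 1 - 1 - 1 - 1) ?h"
        using F R r sat by - (rule close_cycle[of _ u "(P @ [w]) @ Q @ [f]" f], auto)
      then show "wins L (r - 1) ?h1" using F R r fo
        by - (rule force_list[where es = "[(v, w), (w, p), (q, f)]"], auto)
    qed (use F R r in auto)
  qed

  have coloured: "wins L r h" if res: "reserved L h p Q q u P v g"
    and c: "incident h c u" "c \<noteq> Green" and r: "3 * g \<le> 2 * r + 1" for h p Q q u P v r c
  proof -
    note R = res[unfolded reserved_def, simplified]
    note E = reserved_ends[OF res]
    note PQ = E(5,6)[THEN gpath_mono]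
    obtain x f f' y a where "apart h u P v [x, f, f', y, a]" "apart h p Q q [x, f, f', y, a]"
      using fresh_apart[OF E(7,5,6)] .
    note F = this[unfolded apart_def, simplified] E(1-4)
    consider "g = 2" | "g = 5" | "3 \<le> g" "g \<noteq> 5" using R by linarith
    then show ?thesis
    proof cases
      case 1
      then show ?thesis using reserved_close res r by auto
    next
      case 3
      show ?thesis
      proof (rule step[of h u x])
        have "gpath (({u, x}, Green) # h) x (x # P) v"
          by (intro gpath_Cons[of _ x u P] PQ)
            (use F in auto)
        then show "wins L (r - 1) (({u, x}, Green) # h)" using F R 3 r
          by - (rule IH_X[of _ p Q q x "x # P" v "g - 1"], auto simp: reserved_def)
      next
        fix d assume d: "d \<noteq> Green" "\<not> incident h d u"
        let ?h1 = "({u, x}, d) # h"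
        have sat: "saturated ?h1 u" using c d by (intro saturatedI[of _ c u d]) auto
        show "wins L (r - 1) ?h1" using F R 3 r sat d
          by - (rule sat_end[of _ p Q q u P v d x], auto simp: reserved_def)
      qed (use F R r 3 in auto)
    next
      case 2
      \<comment> \<open>Extending at \<open>u\<close> could lead to the exceptional
        \<open>g = 4\<close> with only six rounds left, so Builder plays at \<open>v\<close> and
        keeps the colour at \<open>u\<close>.\<close>
      show ?thesis
      proof (rule step[of h v x])
        have "gpath (({v, x}, Green) # h) u (P @ [x]) x"
          by (intro gpath_snoc[of _ v x u P] PQ)
            (use F in auto)
        then show "wins L (r - 1) (({v, x}, Green) # h)" using F R 2 r c
          by - (rule IH_D[of _ p Q q u "P @ [x]" x 4 c], auto simp: reserved_def)
      next
        fix d assume d: "d \<noteq> Green" "\<not> incident h d v"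
        let ?h1 = "({v, x}, d) # h"
        have DD: "wins L (r - 1 - 1) (({u, x}, Green) # ?h1)"
        proof -
          have "gpath (({u, x}, Green) # ?h1) x (x # P) v"
            by (intro gpath_Cons[of _ x u P] PQ)
              (use F in auto)
          then show ?thesis using F R 2 r c d
            by - (rule both_coloured[of _ p Q q x "x # P" v d], auto simp: reserved_def)
        qed
        show "wins L (r - 1) ?h1"
        proof (cases "d = c")
          case False
          then have "forced ?h1 u x" using c d by (intro opposite_forced[of _ c u d]) auto
          then show ?thesis using DD F R 2 r by - (rule force_list[where es = "[(u, x)]"], auto)
        next
          case True
          \<comment> \<open>With equal colours, a non-green edge from \<open>u\<close> to
            \<open>x\<close> saturates both vertices, and the five remaining cycle edges are all
            forced.\<close>
          show ?thesis
          proof (rule step[of _ u x])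
            fix d' assume d': "d' \<noteq> Green" "\<not> incident ?h1 d' u"
            let ?h2 = "({u, x}, d') # ?h1"
            let ?h = "({x, f}, Green) # ({f', x}, Green) # ({q, f'}, Green) # ({v, p}, Green) # ?h2"
            have sat: "saturated ?h2 u" "saturated ?h2 x"
              using c d d' True by (auto intro: saturatedI[of _ c _ d'])
            have "gpath ?h u (P @ (Q @ [f']) @ [x, f]) f"
              by (intro gpath_append[of _ u P v p] gpath_snoc2[of _ f' x f p "Q @ [f']"] gpath_snoc[of _ q f' p Q] PQ)
                (use F R in auto)
            then have "wins L (r - 1 - 1 - 1 - 1 - 1 - 1) ?h" using F R r 2 sat
              by - (rule close_cycle[of _ u "P @ (Q @ [f']) @ [x, f]" f], auto)
            then show "wins L (r - 1 - 1) ?h2" using F R r 2 sat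
              by - (rule force_list[where es = "[(v, p), (q, f'), (f', x), (x, f)]"], auto)
          qed (use DD F R r 2 in auto)
        qed
      qed (use F R r 2 in auto)
    qed
  qed

  have free: "wins L r h" if res: "reserved L h p Q q u P v g"
    and r: "3 * g \<le> 2 * r" "g = 4 \<Longrightarrow> 7 \<le> r" for h p Q q u P v r
  proof -
    note R = res[unfolded reserved_def, simplified]
    note E = reserved_ends[OF res]
    note PQ = E(5,6)[THEN gpath_mono]
    obtain x y a f w where "apart h u P v [x, y, a, f, w]" "apart h p Q q [x, y, a, f, w]"
      using fresh_apart[OF E(7,5,6)] .
    note F = this[unfolded apart_def, simplified] E(1-4)
    have "2 \<le> g" using R by simp
    then have "g = 2 \<or> ((odd g \<or> g = 4) \<and> 3 \<le> g) \<or> (even g \<and> 6 \<le> g)" by presburger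
    then consider "g = 2" | "odd g \<or> g = 4" "3 \<le> g" | "even g" "6 \<le> g" by blast
    then show ?thesis
    proof cases
      case 1
      then show ?thesis using reserved_close res r by auto
    next
      case 2
      show ?thesis
      proof (rule step[of h u x])
        have "gpath (({u, x}, Green) # h) x (x # P) v"
          by (intro gpath_Cons[of _ x u P] PQ)
            (use F in auto)
        then show "wins L (r - 1) (({u, x}, Green) # h)" using F R 2 r
          by - (rule IH_X[of _ p Q q x "x # P" v "g - 1"], auto simp: reserved_def)
      next
        fix d assume d: "d \<noteq> Green"
        \<comment> \<open>The half round lost by a coloured edge is regained by parity when
          \<open>g\<close> is odd, and from the extra round granted when
          \<open>g = 4\<close>.\<close>
        have "3 * g \<le> 2 * (r - 1) + 1" using r 2 by (cases "g = 4") (simp, presburger)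
        then show "wins L (r - 1) (({u, x}, d) # h)" using F R d
          by - (rule coloured[of _ p Q q u P v d], auto simp: reserved_def)
      qed (use F R r 2 in auto)
    next
      case 3
      then obtain m where m: "g = 2 * m" "3 \<le> m" by auto
      \<comment> \<open>For even \<open>g\<close> the bound may be tight, so a coloured edge cannot
        simply be handed to \<open>coloured\<close>. Builder adds edges at \<open>x\<close> until
        three cycle edges are gained in four or five rounds, with a coloured end if it took five.
        The number \<open>g - 3\<close> is odd and thus never the exceptional 4.\<close>
      show ?thesis
      proof (rule step[of h u x])
        have "gpath (({u, x}, Green) # h) x (x # P) v"
          by (intro gpath_Cons[of _ x u P] PQ)
            (use F in auto)
        then show "wins L (r - 1) (({u, x}, Green) # h)" using F R m r
          by - (rule IH_X[of _ p Q q x "x # P" v "g - 1"], auto simp: reserved_def)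
      next
        fix c assume c: "c \<noteq> Green" "\<not> incident h c u"
        let ?h1 = "({u, x}, c) # h"
        show "wins L (r - 1) ?h1"
        proof (rule step[of _ x y])
          fix d assume d: "d \<noteq> Green" "\<not> incident ?h1 d x"
          let ?h2 = "({x, y}, d) # ?h1"
          let ?h = "({x, f}, Green) # ({v, x}, Green) # ({y, u}, Green) # ?h2"
          have sat: "saturated ?h2 x" using c d by (intro saturatedI[of _ c x d]) auto
          have fo: "forced ?h2 y u" using c d by (intro opposite_forced[of _ d y c]) auto
          have "gpath ?h y (y # P @ [x, f]) f"
            by (intro gpath_Cons[of _ y u "P @ [x, f]"] gpath_snoc2[of _ v x f u P] PQ)
              (use F R in auto)
          then have "wins L (r - 1 - 1 - 1 - 1 - 1) ?h" using F R m r d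
            by - (rule IH_D[of _ p Q q y "y # P @ [x, f]" f "g - 3" d], auto simp: reserved_def)
          then show "wins L (r - 1 - 1) ?h2" using F R m r sat fo
            by - (rule force_list[where es = "[(y, u), (v, x), (x, f)]"], auto)
        next
          let ?h2 = "({x, y}, Green) # ?h1"
          show "wins L (r - 1 - 1) ?h2"
          proof (rule step[of _ a x])
            fix d assume d: "d \<noteq> Green" "\<not> incident ?h2 d x"
            let ?h3 = "({a, x}, d) # ?h2"
            let ?h = "({v, x}, Green) # ({a, u}, Green) # ?h3"
            have sat: "saturated ?h3 x" using c d by (intro saturatedI[of _ c x d]) auto
            have fo: "forced ?h3 a u" using c d by (intro opposite_forced[of _ d a c]) auto
            have "gpath ?h a (a # P @ [x, y]) y"
              by (intro gpath_Cons[of _ a u "P @ [x, y]"] gpath_snoc2[of _ v x y u P] PQ)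
                (use F R in auto)
            then have "wins L (r - 1 - 1 - 1 - 1 - 1) ?h" using F R m r d
              by - (rule IH_D[of _ p Q q a "a # P @ [x, y]" y "g - 3" d], auto simp: reserved_def)
            then show "wins L (r - 1 - 1 - 1) ?h3" using F R m r sat fo
              by - (rule force_list[where es = "[(a, u), (v, x)]"], auto)
          next
            let ?h3 = "({a, x}, Green) # ?h2"
            show "wins L (r - 1 - 1 - 1) ?h3"
            proof (rule step[of _ a u])
              let ?h = "({a, u}, Green) # ?h3"
              have "gpath ?h y (y # x # a # P) v"
                by (intro gpath_Cons[of _ y x "x # a # P"] gpath_Cons[of _ x a "a # P"] gpath_Cons[of _ a u P] PQ)
                  (use F R in auto)
              then show "wins L (r - 1 - 1 - 1 - 1) ?h" using F R m r
                by - (rule IH_X[of _ p Q q y "y # x # a # P" v "g - 3"], auto simp: reserved_def)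
            next
              fix d assume d: "d \<noteq> Green" "\<not> incident ?h3 d u"
              let ?h4 = "({a, u}, d) # ?h3"
              let ?h = "({y, u}, Green) # ?h4"
              have sat: "saturated ?h4 u" using c d by (intro saturatedI[of _ c u d]) auto
              have "gpath ?h a (a # x # y # P) v"
                by (intro gpath_Cons[of _ a x "x # y # P"] gpath_Cons[of _ x y "y # P"] gpath_Cons[of _ y u P] PQ)
                  (use F R in auto)
              then have "wins L (r - 1 - 1 - 1 - 1 - 1) ?h" using F R m r d
                by - (rule IH_D[of _ p Q q a "a # x # y # P" v "g - 3" d], auto simp: reserved_def)
              then show "wins L (r - 1 - 1 - 1 - 1) ?h4" using F R m r sat
                by - (rule force_list[where es = "[(y, u)]"], auto)
            qed (use F R m r in auto)
          qed (use F R m r in auto)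
        qed (use F R m r in auto)
      qed (use F R m r in auto)
    qed
  qed
  show ?case using free[OF less.prems] coloured[OF less.prems] sat_end[OF less.prems] by blast
qed

lemma reserved_free:
  "reserved L h p Q q u P v g \<Longrightarrow> 3 * g \<le> 2 * r \<Longrightarrow> (g = 4 \<Longrightarrow> 7 \<le> r) \<Longrightarrow> wins L r h"
  using reserved_wins by blast

lemma reserved_coloured:
  "reserved L h p Q q u P v g \<Longrightarrow> incident h c u \<Longrightarrow> c \<noteq> Green \<Longrightarrow> 3 * g \<le> 2 * r + 1 \<Longrightarrow> wins L r h"
  using reserved_wins by blast

lemma reserved_saturated:
  "reserved L h p Q q u P v g \<Longrightarrow> saturated h u \<Longrightarrow> incident h c y \<Longrightarrow> c \<noteq> Green \<Longrightarrow>
    y \<notin> set P \<Longrightarrow> y \<notin> set Q \<Longrightarrow> \<not> drawn h q y \<Longrightarrow> 3 * g \<le> 2 * r + 3 \<Longrightarrow> wins L r h"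
  using reserved_wins by blast

section \<open>A single green path\<close>

text \<open>Again \<open>g\<close> counts the edges missing from the cycle.\<close>

definition open_path :: "nat \<Rightarrow> history \<Rightarrow> nat \<Rightarrow> nat list \<Rightarrow> nat \<Rightarrow> nat \<Rightarrow> bool" where
  "open_path L h u P v g \<longleftrightarrow> board h \<and> gpath h u P v \<and> u \<noteq> v \<and> length P + g = L + 1 \<and> 2 \<le> g"

lemma open_path_rev: "open_path L h u P v g \<Longrightarrow> open_path L h v (rev P) u g"
  by (auto simp: open_path_def gpath_rev)

lemma open_path_weaken:
  "open_path L h u P v g \<Longrightarrow> x \<noteq> y \<Longrightarrow> open_path L (({x, y}, c) # h) u P v g"
  by (auto simp: open_path_def)

lemma fresh_open_path:
  assumes "open_path L h u P v g"
  obtains x y a f w where "apart h u P v [x, y, a, f, w]"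
proof -
  have op: "board h" "gpath h u P v" using assms by (auto simp: open_path_def)
  obtain x y a f w where "apart h u P v [x, y, a, f, w]" "apart h u P v [x, y, a, f, w]"
    using fresh_apart[OF op(1,2,2)] .
  then show thesis by (intro that)
qed

text \<open>The path itself becomes the reserve, and a new path is started at \<open>y\<close>.\<close>

lemma two_saturated_ends:
  assumes op: "open_path L h p Q q g" and sat: "saturated h p" "saturated h q"
    and y: "incident h c y" "c \<noteq> Green" "y \<notin> set Q" "\<not> drawn h q y"
    and r: "3 \<le> g" "3 * g \<le> 2 * r + 2"
  shows "wins L r h"
proof -
  note R = op[unfolded open_path_def]
  obtain z f x a w where "apart h p Q q [z, f, x, a, w]"
    using fresh_open_path[OF op] .
  note F = this[unfolded apart_def, simplified]
  have yz: "y \<noteq> z" "y \<noteq> f" using y F by (auto dest: untouched(1))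
  have yp: "y \<noteq> q" "y \<noteq> p" using y R gpath_touched[of h p Q q] by auto
  \<comment> \<open>Either answer leads to a two-vertex path beside the reserve \<open>Q\<close>.
    Its end \<open>y\<close> is coloured, or saturated with \<open>z\<close> as the spare
    vertex.\<close>
  show ?thesis
  proof (rule step[of h y z])
    let ?h = "({y, z}, Green) # h"
    have "gpath ?h y [y, z] z" using yz by (auto simp: gpath_def)
    then have "reserved L ?h p Q q y [y, z] z (g - 1)"
      using F R yz yp y r sat by (auto simp: reserved_def drawn_commute)
    then show "wins L (r - 1) ?h"
      by (rule reserved_coloured[where c = c]) (use y r in auto)
  next
    fix d assume d: "d \<noteq> Green" "\<not> incident h d y"
    let ?h1 = "({y, z}, d) # h"
    let ?h = "({y, f}, Green) # ?h1"
    have sy: "saturated ?h1 y" using y d by (intro saturatedI[of _ c y d]) auto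
    have "gpath ?h y [y, f] f" using yz by (auto simp: gpath_def)
    then have "reserved L ?h p Q q y [y, f] f (g - 1)"
      using F R yz yp y r sat by (auto simp: reserved_def drawn_commute)
    then have "wins L (r - 1 - 1) ?h"
      by (rule reserved_saturated[of _ _ _ _ _ _ _ _ _ d z]) (use F yz yp y r sy d in auto)
    then show "wins L (r - 1) ?h1"
      using F R yz yp r sy by - (rule force_list[where es = "[(y, f)]"], auto)
  qed (use F R yz r in auto)
qed

text \<open>The saturated end makes the closing edge forced, so Builder only works at
  \<open>u\<close>. Once \<open>u\<close> is saturated too, \<open>two_saturated_ends\<close> takes
  over, except that for \<open>g = 2\<close> one new vertex is joined to both ends.\<close>

lemma saturated_end:
  assumes "open_path L h u P v g" "saturated h v"
  shows "(3 * g + 2 \<le> 2 * r \<longrightarrow> wins L r h) \<and>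
    (incident h c u \<and> c \<noteq> Green \<and> 3 * g \<le> 2 * r \<and> (g \<noteq> 2 \<longrightarrow> 3 * g < 2 * r) \<longrightarrow> wins L r h)"
  using assms
proof (induction g arbitrary: h u P r c rule: less_induct)
  case (less g)
  have IH_0: "wins L r h" if "open_path L h u P v g'" "g' < g" "saturated h v" "3 * g' + 2 \<le> 2 * r"
    for h u P g' r
    using less.IH[OF that(2,1,3)] that(4) by blast
  have IH_C: "wins L r h" if "open_path L h u P v g'" "g' < g" "saturated h v" "incident h c u" "c \<noteq> Green"
      "3 * g' \<le> 2 * r" "g' \<noteq> 2 \<Longrightarrow> 3 * g' < 2 * r" for h u P g' r c
    using less.IH[OF that(2,1,3)] that(4-) by blast

  have coloured: "wins L r h" if op: "open_path L h u P v g" and sat: "saturated h v"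
    and c: "incident h c u" "c \<noteq> Green" and r: "3 * g \<le> 2 * r" "g \<noteq> 2 \<Longrightarrow> 3 * g < 2 * r" for h u P r c
  proof -
    note R = op[unfolded open_path_def]
    note PQ = R[THEN conjunct2, THEN conjunct1, THEN gpath_mono]
    obtain x f y a w where "apart h u P v [x, f, y, a, w]"
      using fresh_open_path[OF op] .
    note F = this[unfolded apart_def, simplified]
    show ?thesis
    proof (rule step[of h u x])
      let ?h = "({u, x}, Green) # h"
      have gp: "gpath ?h x (x # P) v"
        by (intro gpath_Cons[of _ x u P] PQ)
          (use F in auto)
      show "wins L (r - 1) ?h"
      proof (cases "g = 2")
        case True
        then show ?thesis using gp F R r sat by - (rule close_cycle[of _ x "x # P" v], auto)
      next
        case False
        then have g: "3 \<le> g" using R by simp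
        with gp R F have "open_path L ?h x (x # P) v (g - 1)" by (auto simp: open_path_def)
        then show ?thesis by (rule IH_0) (use g r sat in auto)
      qed
    next
      fix d assume d: "d \<noteq> Green" "\<not> incident h d u"
      let ?h = "({u, x}, d) # h"
      have su: "saturated ?h u" using c d by (intro saturatedI[of _ c u d]) auto
      show "wins L (r - 1) ?h"
      proof (cases "g = 2")
        case True
        let ?h' = "({f, u}, Green) # ?h"
        have "gpath ?h' f (f # P) v"
          by (intro gpath_Cons[of _ f u P] PQ)
            (use F in auto)
        then have "wins L (r - 1 - 1) ?h'"
          using True F R r sat by - (rule close_cycle[of _ f "f # P" v], auto)
        then show ?thesis
          using True F R r su by - (rule force_list[where es = "[(f, u)]"], auto)
      next
        case False
        then have "3 \<le> g" using R by simp
        then show ?thesis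
          by - (rule two_saturated_ends[OF open_path_weaken[OF op], where y = x and c = d],
              use F R r su sat d in auto)
      qed
    qed (use F R r in auto)
  qed

  have free: "wins L r h" if op: "open_path L h u P v g" and sat: "saturated h v"
    and r: "3 * g + 2 \<le> 2 * r" for h u P r
  proof -
    note R = op[unfolded open_path_def]
    note PQ = R[THEN conjunct2, THEN conjunct1, THEN gpath_mono]
    obtain x y w f a where "apart h u P v [x, y, w, f, a]"
      using fresh_open_path[OF op] .
    note F = this[unfolded apart_def, simplified]
    show ?thesis
    proof (rule step[of h u x])
      let ?h = "({u, x}, Green) # h"
      have gp: "gpath ?h x (x # P) v"
        by (intro gpath_Cons[of _ x u P] PQ)
          (use F in auto)
      show "wins L (r - 1) ?h"
      proof (cases "g = 2")
        case True
        then show ?thesis using gp F R r sat by - (rule close_cycle[of _ x "x # P" v], auto)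
      next
        case False
        then have g: "3 \<le> g" using R by simp
        with gp R F have "open_path L ?h x (x # P) v (g - 1)" by (auto simp: open_path_def)
        then show ?thesis by (rule IH_0) (use g r sat in auto)
      qed
    next
      fix c assume c: "c \<noteq> Green" "\<not> incident h c u"
      let ?h1 = "({u, x}, c) # h"
      show "wins L (r - 1) ?h1"
      proof (rule step[of _ u y])
        fix d assume d: "d \<noteq> Green" "\<not> incident ?h1 d u"
        let ?h2 = "({u, y}, d) # ?h1"
        have su: "saturated ?h2 u" using c d by (intro saturatedI[of _ c u d]) auto
        show "wins L (r - 1 - 1) ?h2"
        proof (cases "g = 2")
          case True
          let ?h = "({f, u}, Green) # ?h2"
          have "gpath ?h f (f # P) v"
            by (intro gpath_Cons[of _ f u P] PQ)
              (use F in auto)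
          then have "wins L (r - 1 - 1 - 1) ?h"
            using True F R r sat by - (rule close_cycle[of _ f "f # P" v], auto)
          then show ?thesis
            using True F R r su by - (rule force_list[where es = "[(f, u)]"], auto)
        next
          case False
          then have "3 \<le> g" using R by simp
          then show ?thesis
            by - (rule two_saturated_ends[OF open_path_weaken[OF open_path_weaken[OF op]], where y = y and c = d],
                use F R r su sat d in auto)
        qed
      next
        let ?h2 = "({u, y}, Green) # ?h1"
        have gp: "gpath ?h2 y (y # P) v"
          by (intro gpath_Cons[of _ y u P] PQ)
            (use F in auto)
        show "wins L (r - 1 - 1) ?h2"
        proof (cases "g = 2")
          case True
          then show ?thesis using gp F R r sat by - (rule close_cycle[of _ y "y # P" v], auto)
        next
          case False
          then have g: "3 \<le> g" "0 < L" using R by auto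
          \<comment> \<open>The coloured vertex \<open>x\<close> lies off the path. A green edge
            from \<open>y\<close> makes it the next end; any other answer saturates it, and
            \<open>[x]\<close> becomes the reserve.\<close>
          show ?thesis
          proof (rule step[of _ y x])
            let ?h = "({y, x}, Green) # ?h2"
            have gp: "gpath ?h x (x # y # P) v"
              by (intro gpath_Cons[of _ x y "y # P"] gpath_Cons[of _ y u P] PQ)
                (use F in auto)
            show "wins L (r - 1 - 1 - 1) ?h"
            proof (cases "g = 3")
              case True
              then show ?thesis using gp F R r sat by - (rule close_cycle[of _ x "x # y # P" v], auto)
            next
              case False
              then have g: "4 \<le> g" "0 < L" using g by auto
              with gp R F have "open_path L ?h x (x # y # P) v (g - 2)" by (auto simp: open_path_def)
              moreover have "3 * (g - 2) < 2 * (r - 1 - 1 - 1)" using r g by linarith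
              ultimately show ?thesis using R r g sat c by - (rule IH_C[where c = c], auto)
            qed
          next
            fix d assume d: "d \<noteq> Green" "\<not> incident ?h2 d x"
            let ?h3 = "({y, x}, d) # ?h2"
            have sx: "saturated ?h3 x" using c d by (intro saturatedI[of _ c x d]) auto
            have px: "gpath ?h3 x [x] x" by (rule gpath_single) simp
            show "wins L (r - 1 - 1 - 1) ?h3"
            proof (rule step[of _ y w])
              let ?h = "({y, w}, Green) # ?h3"
              have gp: "gpath ?h w (w # y # P) v"
                by (intro gpath_Cons[of _ w y "y # P"] gpath_Cons[of _ y u P] PQ)
                  (use F in auto)
              show "wins L (r - 1 - 1 - 1 - 1) ?h"
              proof (cases "g = 3")
                case True
                then show ?thesis using gp F R r sat by - (rule close_cycle[of _ w "w # y # P" v], auto)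
              next
                case False
                then have g: "4 \<le> g" "0 < L" using g by auto
                with gp R F sx px have "reserved L ?h x [x] x w (w # y # P) v (g - 2)"
                  by (auto simp: reserved_def)
                moreover have "3 * (g - 2) \<le> 2 * (r - 1 - 1 - 1 - 1) + 1" using r g by linarith
                ultimately show ?thesis using sat c
                  by (intro reserved_coloured[OF reserved_rev, of _ _ _ _ _ _ _ _ _ c])
                    (auto simp: saturated_def)
              qed
            next
              fix b assume b: "b \<noteq> Green" "\<not> incident ?h3 b y"
              let ?h4 = "({y, w}, b) # ?h3"
              let ?h = "({f, y}, Green) # ?h4"
              have sy: "saturated ?h4 y" using b d by (intro saturatedI[of _ d y b]) auto
              have gp: "gpath ?h f (f # y # P) v"
                by (intro gpath_Cons[of _ f y "y # P"] gpath_Cons[of _ y u P] PQ)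
                  (use F in auto)
              have "wins L (r - 1 - 1 - 1 - 1 - 1) ?h"
              proof (cases "g = 3")
                case True
                then show ?thesis using gp F R r sat by - (rule close_cycle[of _ f "f # y # P" v], auto)
              next
                case False
                then have g: "4 \<le> g" "0 < L" using g by auto
                with gp R F sx px have "reserved L ?h x [x] x f (f # y # P) v (g - 2)"
                  by (auto simp: reserved_def)
                moreover have "3 * (g - 2) \<le> 2 * (r - 1 - 1 - 1 - 1 - 1) + 3" using r g by linarith
                ultimately show ?thesis using sat b F
                  by (intro reserved_saturated[OF reserved_rev, of _ _ _ _ _ _ _ _ _ b w]) auto
              qed
              then show "wins L (r - 1 - 1 - 1 - 1) ?h4"
                using g F R r sy by - (rule force_list[where es = "[(f, y)]"], auto)
            qed (use F R r g in auto)
          qed (use F R r g in auto)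
        qed
      qed (use F R r in auto)
    qed (use F R r in auto)
  qed
  show ?case using free[OF less.prems] coloured[OF less.prems] by blast
qed

lemma saturated_end_free:
  "open_path L h u P v g \<Longrightarrow> saturated h v \<Longrightarrow> 3 * g + 2 \<le> 2 * r \<Longrightarrow> wins L r h"
  using saturated_end by blast

lemma saturated_end_coloured:
  "open_path L h u P v g \<Longrightarrow> saturated h v \<Longrightarrow> incident h c u \<Longrightarrow> c \<noteq> Green \<Longrightarrow> 3 * g \<le> 2 * r \<Longrightarrow>
    (g \<noteq> 2 \<Longrightarrow> 3 * g < 2 * r) \<Longrightarrow> wins L r h"
  using saturated_end by blast

text \<open>With two edges missing, Builder hangs new vertices on one end and joins them to the other end:
  every such closing edge that is not green brings the second end closer to saturation.\<close>

lemma two_coloured_ends_2: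
  assumes op: "open_path L h u P v 2" and c: "incident h c u" "c \<noteq> Green" and d: "incident h d v" "d \<noteq> Green"
    and r: "5 \<le> r"
  shows "wins L r h"
proof -
  note R = op[unfolded open_path_def]
  note PQ = R[THEN conjunct2, THEN conjunct1, THEN gpath_mono]
  obtain y x a f w where "apart h u P v [y, x, a, f, w]"
    using fresh_open_path[OF op] .
  note F = this[unfolded apart_def, simplified]
  show ?thesis
  proof (rule step[of h u y])
    fix b assume b: "b \<noteq> Green" "\<not> incident h b u"
    have "saturated (({u, y}, b) # h) u" using b c by (intro saturatedI[of _ c u b]) auto
    then show "wins L (r - 1) (({u, y}, b) # h)"
      by - (rule saturated_end_free[OF open_path_rev[OF open_path_weaken[OF op]]], use F r in auto)
  next
    let ?h1 = "({u, y}, Green) # h"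
    show "wins L (r - 1) ?h1"
    proof (rule step[of _ v y])
      let ?h = "({v, y}, Green) # ?h1"
      have "gpath ?h y (y # P) v"
        by (intro gpath_Cons[of _ y u P] PQ)
          (use F in auto)
      then show "wins L (r - 1 - 1) ?h"
        using R by (intro won_wins won_green_cycle[of _ y "y # P" v]) auto
    next
      fix b assume b: "b \<noteq> Green" "\<not> incident ?h1 b v"
      have "saturated (({v, y}, b) # ?h1) v" using b d by (intro saturatedI[of _ d v b]) auto
      then show "wins L (r - 1 - 1) (({v, y}, b) # ?h1)"
        by - (rule saturated_end_coloured[OF open_path_weaken[OF open_path_weaken[OF op]], where c = c],
          use F c r in auto)
    qed (use F R r in auto)
  qed (use F R r in auto)
qed

text \<open>Builder hangs \<open>x\<close> on the other end \<open>v\<close>. A non-green answer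
  gives two coloured ends with five rounds left; after a green one, the edge from \<open>x\<close>
  to \<open>u\<close> closes the cycle or saturates \<open>u\<close>.\<close>

lemma coloured_end_2:
  assumes op: "open_path L h u P v 2" and c: "incident h c u" "c \<noteq> Green" and r: "6 \<le> r"
  shows "wins L r h"
proof -
  note R = op[unfolded open_path_def]
  note PQ = R[THEN conjunct2, THEN conjunct1, THEN gpath_mono]
  obtain x y a f w where "apart h u P v [x, y, a, f, w]"
    using fresh_open_path[OF op] .
  note F = this[unfolded apart_def, simplified]
  show ?thesis
  proof (rule step[of h v x])
    fix b assume b: "b \<noteq> Green" "\<not> incident h b v"
    show "wins L (r - 1) (({v, x}, b) # h)"
      by (rule two_coloured_ends_2[OF open_path_weaken[OF op], where c = c and d = b]) (use F b c r in auto)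
  next
    let ?h1 = "({v, x}, Green) # h"
    show "wins L (r - 1) ?h1"
    proof (rule step[of _ x u])
      let ?h = "({x, u}, Green) # ?h1"
      have "gpath ?h u (P @ [x]) x"
        by (intro gpath_snoc[of _ v x u P] PQ)
          (use F in auto)
      then show "wins L (r - 1 - 1) ?h"
        using R by (intro won_wins won_green_cycle[of _ u "P @ [x]" x]) auto
    next
      fix b assume b: "b \<noteq> Green" "\<not> incident ?h1 b u"
      have "saturated (({x, u}, b) # ?h1) u" using b c by (intro saturatedI[of _ c u b]) auto
      then show "wins L (r - 1 - 1) (({x, u}, b) # ?h1)"
        by - (rule saturated_end_free[OF open_path_rev[OF open_path_weaken[OF open_path_weaken[OF op]]]],
          use F r in auto)
    qed (use F R r in auto)
  qed (use F R r in auto)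
qed

text \<open>Builder plays at \<open>v\<close> first and keeps the colour of \<open>u\<close>. If the
  edge to \<open>x\<close> is not green, the edge from \<open>u\<close> to \<open>x\<close> is
  forced when the two colours differ; when they agree, it is green or saturates
  \<open>u\<close>.\<close>

lemma coloured_end_3:
  assumes op: "open_path L h u P v 3" and c: "incident h c u" "c \<noteq> Green" and r: "7 \<le> r"
  shows "wins L r h"
proof -
  note R = op[unfolded open_path_def]
  note PQ = R[THEN conjunct2, THEN conjunct1, THEN gpath_mono]
  obtain x y a f w where "apart h u P v [x, y, a, f, w]"
    using fresh_open_path[OF op] .
  note F = this[unfolded apart_def, simplified]
  show ?thesis
  proof (rule step[of h v x])
    let ?h = "({v, x}, Green) # h"
    have "gpath ?h u (P @ [x]) x"
      by (intro gpath_snoc[of _ v x u P] PQ)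
        (use F in auto)
    then have "open_path L ?h u (P @ [x]) x 2" using F R by (auto simp: open_path_def)
    then show "wins L (r - 1) ?h"
      by (rule coloured_end_2[where c = c]) (use c r in auto)
  next
    fix d assume d: "d \<noteq> Green" "\<not> incident h d v"
    let ?h1 = "({v, x}, d) # h"
    let ?h = "({u, x}, Green) # ?h1"
    have "gpath ?h x (x # P) v"
      by (intro gpath_Cons[of _ x u P] PQ)
        (use F in auto)
    then have "open_path L ?h x (x # P) v 2" using F R by (auto simp: open_path_def)
    then have DD: "wins L (r - 1 - 1) ?h"
      by (rule two_coloured_ends_2[where c = d and d = d]) (use d r in auto)
    show "wins L (r - 1) ?h1"
    proof (cases "d = c")
      case False
      then have "forced ?h1 u x" using c d by (intro opposite_forced[of _ c u d]) auto
      then show ?thesis using DD F R r by - (rule force_list[where es = "[(u, x)]"], auto)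
    next
      case True
      show ?thesis
      proof (rule step[of _ u x])
        fix b assume b: "b \<noteq> Green" "\<not> incident ?h1 b u"
        have "saturated (({u, x}, b) # ?h1) u" using b c by (intro saturatedI[of _ c u b]) auto
        then show "wins L (r - 1 - 1) (({u, x}, b) # ?h1)"
          by - (rule saturated_end_coloured[OF open_path_rev[OF open_path_weaken[OF open_path_weaken[OF op]]], where c = d],
            use F d r in auto)
      qed (use DD F R r in auto)
    qed
  qed (use F R r in auto)
qed

text \<open>The path is extended at \<open>v\<close>, so that the colour at \<open>u\<close> stays
  available for forcing. The values 2 and 3 of \<open>g\<close> are the short endgames above; 5 is
  exceptional because three edges gained in four rounds lead to \<open>g = 2\<close>, which asks for
  six rounds.\<close>

lemma coloured_end:
  assumes "open_path L h u P v g" "incident h c u" "c \<noteq> Green"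
    "3 * g + 3 \<le> 2 * r" "g \<in> {2, 3, 5} \<Longrightarrow> 3 * g + 5 \<le> 2 * r"
  shows "wins L r h"
  using assms
proof (induction g arbitrary: h u P v r c rule: less_induct)
  case (less g)
  note op = less.prems(1) and c = less.prems(2,3) and r = less.prems(4,5)
  note R = op[unfolded open_path_def]
  consider "g = 2" | "g = 3" | "4 \<le> g" using R by linarith
  then show ?case
  proof cases
    case 1
    then show ?thesis using coloured_end_2[of L h u P v c r] op c r by auto
  next
    case 2
    then show ?thesis using coloured_end_3[of L h u P v c r] op c r by auto
  next
    case 3
    then have g: "4 \<le> g" "3 \<le> L" using R by auto
    note PQ = R[THEN conjunct2, THEN conjunct1, THEN gpath_mono]
    obtain x y w f z where "apart h u P v [x, y, w, f, z]"
      using fresh_open_path[OF op] .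
    note F = this[unfolded apart_def, simplified]
    show ?thesis
    proof (rule step[of h v x])
      let ?h = "({v, x}, Green) # h"
      have "gpath ?h u (P @ [x]) x"
        by (intro gpath_snoc[of _ v x u P] PQ)
          (use F in auto)
      then have "open_path L ?h u (P @ [x]) x (g - 1)" using F R g by (auto simp: open_path_def)
      \<comment> \<open>If \<open>g - 1\<close> is 3 or 5, then \<open>3 * g + 3\<close> is odd and
        rounding supplies the extra room.\<close>
      moreover have "3 * (g - 1) + 3 \<le> 2 * (r - 1)" "g - 1 \<in> {2, 3, 5} \<Longrightarrow> 3 * (g - 1) + 5 \<le> 2 * (r - 1)"
        using r g by auto
      ultimately show "wins L (r - 1) ?h"
        using c g by - (rule less.IH[of "g - 1" _ _ _ _ c], auto)
    next
      fix d assume d: "d \<noteq> Green" "\<not> incident h d v"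
      let ?h1 = "({v, x}, d) # h"
      show "wins L (r - 1) ?h1"
      proof (rule step[of _ v y])
        fix b assume b: "b \<noteq> Green" "\<not> incident ?h1 b v"
        let ?h2 = "({v, y}, b) # ?h1"
        have sv: "saturated ?h2 v" using b d by (intro saturatedI[of _ d v b]) auto
        \<comment> \<open>The vertices \<open>x\<close> and \<open>y\<close> carry the two colours
          met at \<open>v\<close>, one of which is \<open>c\<close>. With \<open>p\<close> of colour
          \<open>c\<close> and \<open>q\<close> of the other one, the edges from \<open>p\<close> to
          \<open>q\<close> and from \<open>q\<close> to \<open>u\<close> join opposite colours and
          are forced.\<close>
        have *: "wins L (r - 1 - 1) ?h2" if p: "incident ?h2 c p" and q: "incident ?h2 q' q" "q' \<noteq> Green" "q' \<noteq> c"
          and pq: "p \<noteq> q" "p \<notin> set P" "q \<notin> set P" "p \<noteq> u" "q \<noteq> u" "p \<noteq> v" "q \<noteq> v"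
            "\<not> drawn ?h2 p q" "\<not> drawn ?h2 q u" for p q q'
        proof -
          let ?h = "({p, q}, Green) # ({q, u}, Green) # ?h2"
          have cu: "incident ?h2 c u" using c by simp
          have fo: "forced ?h2 p q" "forced ?h2 q u"
            using opposite_forced[OF p q(1) c(2) q(2)] opposite_forced[OF q(1) cu q(2) c(2)] q(3) by auto
          have "gpath ?h p (p # q # P) v"
            by (intro gpath_Cons[of _ p q "q # P"] gpath_Cons[of _ q u P] PQ)
              (use F pq in auto)
          then have "open_path L ?h p (p # q # P) v (g - 2)" using F R g pq by (auto simp: open_path_def)
          moreover have "3 * (g - 2) < 2 * (r - 1 - 1 - 1 - 1)" using r g by linarith
          ultimately have "wins L (r - 1 - 1 - 1 - 1) ?h"
            using sv c p by - (rule saturated_end_coloured[where c = c], auto)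
          then show ?thesis
            using fo F R pq r g by - (rule force_list[where es = "[(q, u), (p, q)]"], auto)
        qed
        show "wins L (r - 1 - 1) ?h2"
        proof (cases "d = c")
          case True
          then show ?thesis using b by - (rule *[of x b y], use F R in auto)
        next
          case False
          then have "b = c" using b c d by (cases b; cases c; cases d) auto
          then show ?thesis using d False by - (rule *[of y d x], use F R in auto)
        qed
      next
        let ?h2 = "({v, y}, Green) # ?h1"
        \<comment> \<open>Builder leads the path back to the coloured \<open>x\<close>: it becomes
          the new end, or it is saturated and serves as reserve.\<close>
        show "wins L (r - 1 - 1) ?h2"
        proof (rule step[of _ y x])
          fix b assume b: "b \<noteq> Green" "\<not> incident ?h2 b x"
          let ?h3 = "({y, x}, b) # ?h2"
          have sx: "saturated ?h3 x" using b d by (intro saturatedI[of _ d x b]) auto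
          have px: "gpath ?h3 x [x] x" by (rule gpath_single) simp
          show "wins L (r - 1 - 1 - 1) ?h3"
          proof (rule step[of _ y w])
            let ?h = "({y, w}, Green) # ?h3"
            have "gpath ?h u (P @ [y, w]) w"
              by (intro gpath_snoc2[of _ v y w u P] PQ)
                (use F in auto)
            then have "reserved L ?h x [x] x u (P @ [y, w]) w (g - 2)"
              using F R g sx px by (auto simp: reserved_def)
            moreover have "3 * (g - 2) \<le> 2 * (r - 1 - 1 - 1 - 1) + 1" using r g by linarith
            ultimately show "wins L (r - 1 - 1 - 1 - 1) ?h"
              using c by - (rule reserved_coloured[where c = c], auto)
          next
            fix e assume e: "e \<noteq> Green" "\<not> incident ?h3 e y"
            let ?h4 = "({y, w}, e) # ?h3"
            let ?h = "({y, f}, Green) # ?h4"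
            have sy: "saturated ?h4 y" using b e by (intro saturatedI[of _ b y e]) auto
            have "gpath ?h u (P @ [y, f]) f"
              by (intro gpath_snoc2[of _ v y f u P] PQ)
                (use F in auto)
            then have "reserved L ?h x [x] x u (P @ [y, f]) f (g - 2)"
              using F R g sx px by (auto simp: reserved_def)
            moreover have "3 * (g - 2) \<le> 2 * (r - 1 - 1 - 1 - 1 - 1) + 1" using r g by linarith
            ultimately have "wins L (r - 1 - 1 - 1 - 1 - 1) ?h"
              using c by - (rule reserved_coloured[where c = c], auto)
            then show "wins L (r - 1 - 1 - 1 - 1) ?h4"
              using sy F R r g by - (rule force_list[where es = "[(y, f)]"], auto)
          qed (use F R r g in auto)
        next
          let ?h3 = "({y, x}, Green) # ?h2"
          have "gpath ?h3 u (P @ [y, x]) x"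
            by (intro gpath_snoc2[of _ v y x u P] PQ)
              (use F in auto)
          then have op3: "open_path L ?h3 u (P @ [y, x]) x (g - 2)"
            using F R g by (auto simp: open_path_def)
          show "wins L (r - 1 - 1 - 1) ?h3"
          proof (cases "g = 4")
            case True
            with op3 have "open_path L ?h3 u (P @ [y, x]) x 2" by simp
            then show ?thesis
              by (rule two_coloured_ends_2[where c = c and d = d]) (use c d True r in auto)
          next
            case False
            then have g: "5 \<le> g" "4 \<le> L" using g R by auto
            \<comment> \<open>Both ends are coloured, so the colour at \<open>u\<close> can be
              spent: either \<open>u\<close> becomes saturated, or the induction continues on the
              reversed path with the colour \<open>d\<close> at \<open>x\<close>.\<close>
            show ?thesis
            proof (rule step[of _ u z])
              let ?h = "({u, z}, Green) # ?h3"
              have "gpath ?h z (z # P @ [y, x]) x"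
                by (intro gpath_Cons[of _ z u "P @ [y, x]"] gpath_snoc2[of _ v y x u P] PQ)
                  (use F in auto)
              moreover obtain m where "g = m + 5" using g by (metis add.commute le_Suc_ex)
              ultimately have "open_path L ?h z (z # P @ [y, x]) x (g - 3)"
                using F R by (auto simp: open_path_def)
              from open_path_rev[OF this] have "open_path L ?h x (rev (z # P @ [y, x])) z (g - 3)" .
              moreover have "3 * (g - 3) + 3 \<le> 2 * (r - 1 - 1 - 1 - 1)"
                "g - 3 \<in> {2, 3, 5} \<Longrightarrow> 3 * (g - 3) + 5 \<le> 2 * (r - 1 - 1 - 1 - 1)"
                using r g by (cases "g = 5"; auto)+
              ultimately show "wins L (r - 1 - 1 - 1 - 1) ?h"
                using d g by - (rule less.IH[of "g - 3" _ _ _ _ d], auto)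
            next
              fix b assume b: "b \<noteq> Green" "\<not> incident ?h3 b u"
              have "saturated (({u, z}, b) # ?h3) u" using b c by (intro saturatedI[of _ c u b]) auto
              moreover have "3 * (g - 2) < 2 * (r - 1 - 1 - 1 - 1)" using r g by linarith
              ultimately show "wins L (r - 1 - 1 - 1 - 1) (({u, z}, b) # ?h3)"
                by - (rule saturated_end_coloured[OF open_path_rev[OF open_path_weaken[OF op3]], where c = d],
                  use F d in auto)
            qed (use F R r g in auto)
          qed
        qed (use F R r g in auto)
      qed (use F R r g in auto)
    qed (use F R r g in auto)
  qed
qed

section \<open>The opening\<close>

text \<open>While Painter answers green, every round yields a cycle edge and the inequality between
  \<open>g\<close> and \<open>r\<close> is preserved exactly. At the first other colour,
  \<open>g + 3 \<le> L\<close> turns it into the budget of \<open>coloured_end\<close>.\<close>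

lemma green_path:
  assumes "open_path L h u P v g" "14 \<le> L" "g + 3 \<le> L" "2 * g + L + 2 \<le> 2 * r"
  shows "wins L r h"
  using assms(1,3,4)
proof (induction g arbitrary: h u P r rule: less_induct)
  case (less g)
  note op = less.prems(1) and r = less.prems(2,3)
  note R = op[unfolded open_path_def]
  note PQ = R[THEN conjunct2, THEN conjunct1, THEN gpath_mono]
  obtain x y a f w where "apart h u P v [x, y, a, f, w]"
    using fresh_open_path[OF op] .
  note F = this[unfolded apart_def, simplified]
  show ?case
  proof (rule step[of h u x])
    fix c assume c: "c \<noteq> Green"
    show "wins L (r - 1) (({u, x}, c) # h)"
      by (rule coloured_end[OF open_path_weaken[OF op], where c = c]) (use F c r assms(2) in auto)
  next
    let ?h = "({u, x}, Green) # h"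
    have gp: "gpath ?h x (x # P) v"
      by (intro gpath_Cons[of _ x u P] PQ)
        (use F in auto)
    show "wins L (r - 1) ?h"
    proof (cases "g = 2")
      case False
      then have "3 \<le> g" using R by simp
      moreover from this gp have "open_path L ?h x (x # P) v (g - 1)" using F R by (auto simp: open_path_def)
      ultimately show ?thesis using r by - (rule less.IH[of "g - 1"], auto)
    next
      case True
      then have op2: "open_path L h u P v 2" using op by simp
      \<comment> \<open>The extended path has \<open>L\<close> vertices. If Painter refuses the
        closing edge, that edge has coloured \<open>v\<close>, and Builder returns to the path
        \<open>P\<close> without \<open>x\<close>.\<close>
      show ?thesis
      proof (rule step[of _ v x])
        have "gpath (({v, x}, Green) # ?h) x (x # P) v" using gp by simp
        then show "wins L (r - 1 - 1) (({v, x}, Green) # ?h)"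
          using R True by (intro won_wins won_green_cycle[of _ x "x # P" v]) auto
      next
        fix c assume c: "c \<noteq> Green"
        show "wins L (r - 1 - 1) (({v, x}, c) # ?h)"
          by (rule coloured_end_2[OF open_path_rev[OF open_path_weaken[OF open_path_weaken[OF op2]]], where c = c])
            (use F c r assms(2) in auto)
      qed (use F R r in auto)
    qed
  qed (use F R r in auto)
qed

text \<open>Here \<open>P\<close> has three vertices, one too few for \<open>green_path\<close>, so
  an immediate coloured edge needs its own answer. Builder joins its outer vertex \<open>x\<close>
  to the other end: green lengthens the path, which keeps a coloured end; otherwise \<open>x\<close>
  is saturated.\<close>

lemma green_path_3:
  assumes op: "open_path L h u P v g" and L: "14 \<le> L" "even L" "L = g + 2" and r: "3 * g + 4 \<le> 2 * r"
  shows "wins L r h"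
proof -
  note R = op[unfolded open_path_def]
  note PQ = R[THEN conjunct2, THEN conjunct1, THEN gpath_mono]
  obtain x y w f z where "apart h u P v [x, y, w, f, z]"
    using fresh_open_path[OF op] .
  note F = this[unfolded apart_def, simplified]
  have g: "12 \<le> g" using L by simp
  show ?thesis
  proof (rule step[of h u x])
    let ?h = "({u, x}, Green) # h"
    have "gpath ?h x (x # P) v"
      by (intro gpath_Cons[of _ x u P] PQ) (use F in auto)
    then have "open_path L ?h x (x # P) v (g - 1)" using F R g by (auto simp: open_path_def)
    then show "wins L (r - 1) ?h"
      by (rule green_path) (use L r g in auto)
  next
    fix c assume c: "c \<noteq> Green" "\<not> incident h c u"
    let ?h1 = "({u, x}, c) # h"
    show "wins L (r - 1) ?h1"
    proof (rule step[of _ v x])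
      let ?h = "({v, x}, Green) # ?h1"
      have "gpath ?h u (P @ [x]) x"
        by (intro gpath_snoc[of _ v x u P] PQ)
          (use F in auto)
      then have "open_path L ?h u (P @ [x]) x (g - 1)" using F R g by (auto simp: open_path_def)
      then show "wins L (r - 1 - 1) ?h"
        by (rule coloured_end[where c = c]) (use c L r g in auto)
    next
      fix d assume d: "d \<noteq> Green" "\<not> incident ?h1 d x"
      let ?h2 = "({v, x}, d) # ?h1"
      have sx: "saturated ?h2 x" using c d by (intro saturatedI[of _ c x d]) auto
      have px: "gpath ?h2 x [x] x" by (rule gpath_single) simp
      show "wins L (r - 1 - 1) ?h2"
      proof (rule step[of _ u y])
        let ?h3 = "({u, y}, Green) # ?h2"
        show "wins L (r - 1 - 1 - 1) ?h3"
        proof (rule step[of _ v w])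
          let ?h = "({v, w}, Green) # ?h3"
          have "gpath ?h y (y # P @ [w]) w"
            by (intro gpath_Cons[of _ y u "P @ [w]"] gpath_snoc[of _ v w u P] PQ)
              (use F in auto)
          then have "reserved L ?h x [x] x y (y # P @ [w]) w (g - 2)"
            using F R g sx px by (auto simp: reserved_def)
          then show "wins L (r - 1 - 1 - 1 - 1) ?h"
            by (rule reserved_free) (use r g in auto)
        next
          fix b assume b: "b \<noteq> Green" "\<not> incident ?h3 b v"
          let ?h4 = "({v, w}, b) # ?h3"
          let ?h = "({v, f}, Green) # ?h4"
          have sv: "saturated ?h4 v" using b d by (intro saturatedI[of _ d v b]) auto
          have "gpath ?h y (y # P @ [f]) f"
            by (intro gpath_Cons[of _ y u "P @ [f]"] gpath_snoc[of _ v f u P] PQ)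
              (use F in auto)
          then have "reserved L ?h x [x] x y (y # P @ [f]) f (g - 2)"
            using F R g sx px by (auto simp: reserved_def)
          then have "wins L (r - 1 - 1 - 1 - 1 - 1) ?h"
            by (rule reserved_free) (use r g in auto)
          then show "wins L (r - 1 - 1 - 1 - 1) ?h4"
            using sv F R r g by - (rule force_list[where es = "[(v, f)]"], auto)
        qed (use F R r g in auto)
      next
        fix e assume e: "e \<noteq> Green" "\<not> incident ?h2 e u"
        let ?h3 = "({u, y}, e) # ?h2"
        have su: "saturated ?h3 u" using c e by (intro saturatedI[of _ c u e]) auto
        show "wins L (r - 1 - 1 - 1) ?h3"
        proof (rule step[of _ v w])
          let ?h4 = "({v, w}, Green) # ?h3"
          let ?h = "({f, u}, Green) # ?h4"
          have "gpath ?h f (f # P @ [w]) w"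
            by (intro gpath_Cons[of _ f u "P @ [w]"] gpath_snoc[of _ v w u P] PQ)
              (use F in auto)
          then have "reserved L ?h x [x] x f (f # P @ [w]) w (g - 2)"
            using F R g sx px by (auto simp: reserved_def)
          then have "wins L (r - 1 - 1 - 1 - 1 - 1) ?h"
            by (rule reserved_free) (use r g in auto)
          then show "wins L (r - 1 - 1 - 1 - 1) ?h4"
            using su F R r g by - (rule force_list[where es = "[(f, u)]"], auto)
        next
          fix b assume b: "b \<noteq> Green" "\<not> incident ?h3 b v"
          let ?h4 = "({v, w}, b) # ?h3"
          \<comment> \<open>Now \<open>u\<close>, \<open>v\<close> and \<open>x\<close> are all
            saturated. Instead of keeping \<open>x\<close> aside, Builder attaches it to the path,
            whose ends \<open>u\<close> and \<open>x\<close> are then saturated, with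
            \<open>y\<close> as the spare vertex.\<close>
          let ?h = "({f, x}, Green) # ({v, f}, Green) # ?h4"
          have sv: "saturated ?h4 v" using b d by (intro saturatedI[of _ d v b]) auto
          have "gpath ?h u (P @ [f, x]) x"
            by (intro gpath_snoc2[of _ v f x u P] PQ)
              (use F in auto)
          then have "open_path L ?h u (P @ [f, x]) x (g - 2)"
            using F R g by (auto simp: open_path_def)
          then have "wins L (r - 1 - 1 - 1 - 1 - 1 - 1) ?h"
            by (rule two_saturated_ends[where y = y and c = e]) (use F R su sx e r g in auto)
          then show "wins L (r - 1 - 1 - 1 - 1) ?h4"
            using sv sx F R r g by - (rule force_list[where es = "[(v, f), (f, x)]"], auto)
        qed (use F R r g in auto)
      qed (use F R r g in auto)
    qed (use F R r g in auto)
  qed (use F R r g in auto)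
qed

text \<open>The opening after one green and one coloured edge at \<open>x\<close>. The set equation
  covers both orders, and the bound on \<open>r\<close> is what the first two rounds leave of the
  total budget.\<close>

lemma opening_mixed:
  assumes h: "set h = {({x, a}, Green), ({x, b}, c)}" and ne: "distinct [x, a, b]" and c: "c \<noteq> Green"
    and L: "14 \<le> L" "even L" and r: "3 * L \<le> 2 * r + 2"
  shows "wins L r h"
proof -
  obtain l where l: "L = l + 14" using L(1) by (metis add.commute le_Suc_ex)
  have B: "board h" using h ne by (auto simp: board_def)
  have green: "green h p q \<longleftrightarrow> {p, q} = {x, a}" for p q
    using h c by (auto simp: green_def)
  have drawn: "drawn h p q \<longleftrightarrow> {p, q} = {x, a} \<or> {p, q} = {x, b}" for p q
    using h by (auto simp: drawn_def)
  have inc: "incident h e p \<longleftrightarrow> (e = Green \<and> p \<in> {x, a}) \<or> (e = c \<and> p \<in> {x, b})" for e p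
    using h by (auto simp: incident_def)
  have tou: "touched h = {x, a, b}" using h by (auto simp: touched_def)
  note H = green drawn inc tou doubleton_eq_iff
  obtain d w t f z where "distinct [d, w, t, f, z]" "d \<notin> touched h" "w \<notin> touched h" "t \<notin> touched h"
    "f \<notin> touched h" "z \<notin> touched h"
    using fresh_vertices[OF B] .
  then have F: "distinct [d, w, t, f, x, a, b]" using ne tou by auto
  show ?thesis
  proof (rule step[of h x d])
    let ?h1 = "({x, d}, Green) # h"
    \<comment> \<open>Builder pulls the coloured \<open>b\<close> into the path; if Painter refuses,
      \<open>b\<close> is saturated.\<close>
    show "wins L (r - 1) ?h1"
    proof (rule step[of _ b a])
      let ?h = "({b, a}, Green) # ?h1"
      have "gpath ?h b [b, a, x, d] d" using F by (auto simp: gpath_def H)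
      then have "open_path L ?h b [b, a, x, d] d (L - 3)" using F B l by (auto simp: open_path_def)
      then show "wins L (r - 1 - 1) ?h"
        by (rule coloured_end[where c = c]) (use c L r F in \<open>auto simp: H\<close>)
    next
      fix e assume e: "e \<noteq> Green" "\<not> incident ?h1 e b"
      let ?h2 = "({b, a}, e) # ?h1"
      have sb: "saturated ?h2 b" using c e by (intro saturatedI[of _ c b e]) (auto simp: H)
      show "wins L (r - 1 - 1) ?h2"
      proof (rule step[of _ a w])
        let ?h = "({a, w}, Green) # ?h2"
        have "gpath ?h w [w, a, x, d] d" "gpath ?h b [b] b" using F by (auto simp: gpath_def H)
        then have "reserved L ?h b [b] b w [w, a, x, d] d (L - 3)"
          using F B l sb by (auto simp: reserved_def H)
        then show "wins L (r - 1 - 1 - 1) ?h"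
          by (rule reserved_free) (use L r in auto)
      next
        fix i assume i: "i \<noteq> Green" "\<not> incident ?h2 i a"
        let ?h3 = "({a, w}, i) # ?h2"
        let ?h = "({d, b}, Green) # ?h3"
        have sa: "saturated ?h3 a" using e i by (intro saturatedI[of _ e a i]) auto
        have "gpath ?h a [a, x, d, b] b" using F by (auto simp: gpath_def H)
        then have "open_path L ?h a [a, x, d, b] b (L - 3)" using F B l by (auto simp: open_path_def)
        then have "wins L (r - 1 - 1 - 1 - 1) ?h"
          by (rule two_saturated_ends[where y = w and c = i]) (use sa sb i L r F in \<open>auto simp: H\<close>)
        then show "wins L (r - 1 - 1 - 1) ?h3"
          using sb F B L r by - (rule force_list[where es = "[(d, b)]"], auto simp: H)
      qed (use F B L r in \<open>auto simp: H\<close>)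
    qed (use F B L r in \<open>auto simp: H\<close>)
  next
    fix e assume e: "e \<noteq> Green" "\<not> incident h e x"
    let ?h1 = "({x, d}, e) # h"
    have ec: "e \<noteq> c" using e inc by auto
    have sx: "saturated ?h1 x" using c e by (intro saturatedI[of _ c x e]) (auto simp: H)
    \<comment> \<open>Now \<open>x\<close> is saturated, and \<open>b\<close> and \<open>d\<close>
      carry different colours. Builder links \<open>b\<close> and \<open>d\<close> through
      \<open>w\<close>; a coloured answer saturates \<open>b\<close> or \<open>d\<close>, which
      gives a second saturated end or a reserve.\<close>
    show "wins L (r - 1) ?h1"
    proof (rule step[of _ b w])
      fix i assume i: "i \<noteq> Green" "\<not> incident ?h1 i b"
      let ?h2 = "({b, w}, i) # ?h1"
      let ?h = "({a, b}, Green) # ?h2"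
      have sb: "saturated ?h2 b" using c i by (intro saturatedI[of _ c b i]) (auto simp: H)
      have "gpath ?h x [x, a, b] b" using F by (auto simp: gpath_def H)
      then have "open_path L ?h x [x, a, b] b (L - 2)" using F B l by (auto simp: open_path_def)
      then have "wins L (r - 1 - 1 - 1) ?h"
        by (rule two_saturated_ends[where y = d and c = e]) (use sx sb e L r F in \<open>auto simp: H\<close>)
      then show "wins L (r - 1 - 1) ?h2"
        using sb F B L r by - (rule force_list[where es = "[(a, b)]"], auto simp: H)
    next
      let ?h2 = "({b, w}, Green) # ?h1"
      show "wins L (r - 1 - 1) ?h2"
      proof (rule step[of _ w d])
        fix i assume i: "i \<noteq> Green" "\<not> incident ?h2 i d"
        let ?h3 = "({w, d}, i) # ?h2"
        let ?h = "({w, x}, Green) # ?h3"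
        have sd: "saturated ?h3 d" using e i by (intro saturatedI[of _ e d i]) auto
        have "gpath ?h b [b, w, x, a] a" "gpath ?h d [d] d" using F by (auto simp: gpath_def H)
        then have "reserved L ?h d [d] d b [b, w, x, a] a (L - 3)"
          using F B l sd by (auto simp: reserved_def H)
        then have "wins L (r - 1 - 1 - 1 - 1) ?h"
          by (rule reserved_coloured[where c = c]) (use c L r in \<open>auto simp: H\<close>)
        then show "wins L (r - 1 - 1 - 1) ?h3"
          using sx F B L r by - (rule force_list[where es = "[(w, x)]"], auto simp: H)
      next
        let ?h3 = "({w, d}, Green) # ?h2"
        show "wins L (r - 1 - 1 - 1) ?h3"
        proof (rule step[of _ b t])
          let ?h4 = "({b, t}, Green) # ?h3"
          let ?h = "({t, x}, Green) # ?h4"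
          have "gpath ?h d [d, w, b, t, x, a] a" using F by (auto simp: gpath_def H)
          then have "open_path L ?h d [d, w, b, t, x, a] a (L - 5)" using F B l by (auto simp: open_path_def)
          then have "wins L (r - 1 - 1 - 1 - 1 - 1) ?h"
            by (rule coloured_end[where c = e]) (use e L r in auto)
          then show "wins L (r - 1 - 1 - 1 - 1) ?h4"
            using sx F B L r by - (rule force_list[where es = "[(t, x)]"], auto simp: H)
        next
          fix i assume i: "i \<noteq> Green" "\<not> incident ?h3 i b"
          let ?h4 = "({b, t}, i) # ?h3"
          have sb: "saturated ?h4 b" using c i by (intro saturatedI[of _ c b i]) (auto simp: H)
          \<comment> \<open>The edge from \<open>d\<close> to \<open>a\<close> works either way: the
            green path \<open>b\<close>, \<open>w\<close>, \<open>d\<close> reaches \<open>x\<close>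
            through \<open>a\<close> starting from the saturated \<open>b\<close>, or
            \<open>d\<close> gets saturated and the path is run backwards from
            \<open>d\<close>.\<close>
          show "wins L (r - 1 - 1 - 1 - 1) ?h4"
          proof (rule step[of _ d a])
            let ?h = "({d, a}, Green) # ?h4"
            have "gpath ?h b [b, w, d, a, x] x" using F by (auto simp: gpath_def H)
            then have "open_path L ?h b [b, w, d, a, x] x (L - 4)" using F B l by (auto simp: open_path_def)
            then show "wins L (r - 1 - 1 - 1 - 1 - 1) ?h"
              by (rule two_saturated_ends[where y = t and c = i]) (use sx sb i L r F in \<open>auto simp: H\<close>)
          next
            fix j assume j: "j \<noteq> Green" "\<not> incident ?h4 j d"
            let ?h5 = "({d, a}, j) # ?h4"
            let ?h = "({b, a}, Green) # ?h5"
            have sd: "saturated ?h5 d" using e j by (intro saturatedI[of _ e d j]) auto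
            have "gpath ?h d [d, w, b, a, x] x" using F by (auto simp: gpath_def H)
            then have "open_path L ?h d [d, w, b, a, x] x (L - 4)" using F B l by (auto simp: open_path_def)
            then have "wins L (r - 1 - 1 - 1 - 1 - 1 - 1) ?h"
              by (rule two_saturated_ends[where y = t and c = i]) (use sx sd i L r F in \<open>auto simp: H\<close>)
            then show "wins L (r - 1 - 1 - 1 - 1 - 1) ?h5"
              using sb F B L r by - (rule force_list[where es = "[(b, a)]"], auto simp: H)
          qed (use F B L r in \<open>auto simp: H\<close>)
        qed (use F B L r in \<open>auto simp: H\<close>)
      qed (use F B L r in \<open>auto simp: H\<close>)
    qed (use F B L r in \<open>auto simp: H\<close>)
  qed (use F B L r in \<open>auto simp: H\<close>)
qed

text \<open>Builder opens with two edges at \<open>x\<close>. Two green answers give a green path on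
  three vertices, one gives \<open>opening_mixed\<close>, and none makes \<open>x\<close> saturated
  with neighbours of different colours.\<close>

lemma wins_empty_board:
  assumes L: "14 \<le> L" "even L" and r: "3 * L + 2 \<le> 2 * r"
  shows "wins L r []"
proof -
  obtain l where l: "L = l + 14" using L(1) by (metis add.commute le_Suc_ex)
  obtain x b a z t f :: nat where F: "distinct [x, b, a, z, t, f]"
  proof
    show "distinct [0, 1, 2, 3, 4, 5 :: nat]" by simp
  qed
  show ?thesis
  proof (rule step[of _ x b])
    let ?h1 = "[({x, b}, Green)]"
    show "wins L (r - 1) ?h1"
    proof (rule step[of _ x a])
      let ?h = "({x, a}, Green) # ?h1"
      have "gpath ?h b [b, x, a] a" using F by (auto simp: gpath_def)
      then have "open_path L ?h b [b, x, a] a (L - 2)" using F l by (auto simp: open_path_def)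
      then show "wins L (r - 1 - 1) ?h"
        by (rule green_path_3) (use L r in auto)
    next
      fix c assume "c \<noteq> Green"
      then show "wins L (r - 1 - 1) (({x, a}, c) # ?h1)"
        using F L r by - (rule opening_mixed[of _ x b a c], auto)
    qed (use F l r in auto)
  next
    fix c assume c: "c \<noteq> Green"
    let ?h1 = "[({x, b}, c)]"
    show "wins L (r - 1) ?h1"
    proof (rule step[of _ x a])
      show "wins L (r - 1 - 1) (({x, a}, Green) # ?h1)"
        using c F L r by - (rule opening_mixed[of _ x a b c], auto)
    next
      fix d assume d: "d \<noteq> Green" "\<not> incident ?h1 d x"
      let ?h2 = "({x, a}, d) # ?h1"
      have cd: "c \<noteq> d" using d by auto
      have sx: "saturated ?h2 x" using c d by (intro saturatedI[of _ c x d]) auto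
      show "wins L (r - 1 - 1) ?h2"
      proof (rule step[of _ a z])
        fix e assume e: "e \<noteq> Green" "\<not> incident ?h2 e a"
        let ?h3 = "({a, z}, e) # ?h2"
        let ?h = "({f, a}, Green) # ({x, f}, Green) # ?h3"
        have sa: "saturated ?h3 a" using d e by (intro saturatedI[of _ d a e]) auto
        have "gpath ?h x [x, f, a] a" using F by (auto simp: gpath_def)
        then have "open_path L ?h x [x, f, a] a (L - 2)" using F l by (auto simp: open_path_def)
        then have "wins L (r - 1 - 1 - 1 - 1 - 1) ?h"
          by (rule two_saturated_ends[where y = b and c = c]) (use sx sa c L r F in auto)
        then show "wins L (r - 1 - 1 - 1) ?h3"
          using sx sa F l r by - (rule force_list[where es = "[(x, f), (f, a)]"], auto)
      next
        let ?h3 = "({a, z}, Green) # ?h2"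
        show "wins L (r - 1 - 1 - 1) ?h3"
        proof (rule step[of _ b t])
          fix e assume e: "e \<noteq> Green" "\<not> incident ?h3 e b"
          let ?h4 = "({b, t}, e) # ?h3"
          let ?h = "({x, f}, Green) # ({z, x}, Green) # ?h4"
          have sb: "saturated ?h4 b" using c e by (intro saturatedI[of _ c b e]) auto
          have "gpath ?h a [a, z, x, f] f" "gpath ?h b [b] b" using F by (auto simp: gpath_def)
          then have "reserved L ?h b [b] b a [a, z, x, f] f (L - 3)"
            using F l sb by (auto simp: reserved_def)
          then have "wins L (r - 1 - 1 - 1 - 1 - 1 - 1) ?h"
            by (rule reserved_coloured[where c = d]) (use d L r in auto)
          then show "wins L (r - 1 - 1 - 1 - 1) ?h4"
            using sx F l r by - (rule force_list[where es = "[(z, x), (x, f)]"], auto)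
        next
          \<comment> \<open>The green edges at \<open>a\<close> and \<open>b\<close> are linked by a
            forced edge, since \<open>a\<close> and \<open>b\<close> carry different colours;
            \<open>x\<close> stays aside as the reserve.\<close>
          let ?h4 = "({b, t}, Green) # ?h3"
          let ?h = "({b, a}, Green) # ?h4"
          have fo: "forced ?h4 b a" using c d cd by (intro opposite_forced[of _ c b d a]) auto
          have "gpath ?h t [t, b, a, z] z" "gpath ?h x [x] x" using F by (auto simp: gpath_def)
          then have "reserved L ?h x [x] x t [t, b, a, z] z (L - 3)"
            using F l sx by (auto simp: reserved_def)
          then have "wins L (r - 1 - 1 - 1 - 1 - 1) ?h"
            by (rule reserved_free) (use L r in auto)
          then show "wins L (r - 1 - 1 - 1 - 1) ?h4"
            using fo F l r by - (rule force_list[where es = "[(b, a)]"], auto)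
        qed (use F l r in auto)
      qed (use F l r in auto)
    qed (use F l r in auto)
  qed (use F l r in auto)
qed

section \<open>From winning positions to a strategy\<close>

text \<open>\<open>legal_builder\<close> asks for an undrawn edge at every history, so the first
  clause is unconditional, while the second speaks only about winning positions.\<close>

definition good_move :: "nat \<Rightarrow> nat \<Rightarrow> history \<Rightarrow> nat set \<Rightarrow> bool" where
  "good_move L r h e \<longleftrightarrow> (\<exists>u v. u \<noteq> v \<and> e = {u, v} \<and> \<not> drawn h u v) \<and>
     (wins L r h \<longrightarrow> won L h \<or> (\<forall>c. wins L (r - 1) ((e, c) # h)))"

lemma good_move_exists: "\<exists>e. good_move L r h e"
proof (cases "wins L r h \<and> \<not> won L h")
  case True
  then obtain s where s: "r = Suc s" by (cases r) auto
  with True obtain u v where "u \<noteq> v" "\<not> drawn h u v" "\<forall>c. wins L s (({u, v}, c) # h)" by auto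
  then show ?thesis using s by (auto simp: good_move_def)
next
  case False
  \<comment> \<open>Any undrawn edge will do here; infinitely many edges meet \<open>0\<close>, and
    only finitely many are drawn.\<close>
  have "inj (\<lambda>n. {0, Suc n})" by (auto simp: inj_def doubleton_eq_iff)
  then have "infinite (range (\<lambda>n. {0, Suc n}))" by (simp add: finite_image_iff)
  then obtain n where "{0, Suc n} \<notin> fst ` set h"
    by (meson List.finite_set finite_imageI finite_subset image_subsetI)
  then have "0 \<noteq> Suc n \<and> {0, Suc n} = {0, Suc n} \<and> \<not> drawn h 0 (Suc n)" by (simp add: drawn_def)
  then show ?thesis using False unfolding good_move_def by blast
qed

text \<open>A strategy sees only the history, so the rounds left are read off as
  \<open>r - length h\<close>. Along any play, a win has occurred or the position remains winning in
  the rounds left.\<close>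

lemma wins_builder_wins_within:
  assumes "wins L r []"
  shows "builder_wins_within (path_graph 3) (path_graph 3) (cycle_graph L) r"
proof -
  define b :: builder where "b h = (SOME e. good_move L (r - length h) h e)" for h
  have b: "good_move L (r - length h) h (b h)" for h
    unfolding b_def by (rule someI_ex) (rule good_move_exists)
  then have "legal_builder b"
    unfolding legal_builder_def good_move_def drawn_def by metis
  moreover have "\<exists>j\<le>r. won L (play b p j)" for p
  proof -
    have len: "length (play b p n) = n" for n by (induction n) (auto simp: Let_def)
    have "(\<exists>j\<le>n. won L (play b p j)) \<or> wins L (r - n) (play b p n)" for n
    proof (induction n)
      case (Suc n)
      then show ?case
      proof
        assume "wins L (r - n) (play b p n)"
        then have "won L (play b p n) \<or> wins L (r - n - 1) (play b p (Suc n))"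
          using b[of "play b p n"] len[of n] unfolding good_move_def by (auto simp: Let_def)
        then show ?thesis by (auto intro: le_SucI)
      qed (auto intro: le_SucI)
    qed (use assms in simp)
    from this[of r] show ?thesis by auto
  qed
  ultimately show ?thesis
    unfolding builder_wins_within_def won_def by blast
qed

theorem theorem4p17:
  fixes k :: nat
  assumes "k \<ge> 4"
  shows "online_ramsey (path_graph 3) (path_graph 3) (cycle_graph (4 * k - 2)) \<le> enat (6 * k - 2)"
proof -
  \<comment> \<open>For \<open>L = 4 * k - 2\<close> the budget is met with equality:
    \<open>3 * L + 2 = 2 * (6 * k - 2)\<close>. The hypothesis on \<open>k\<close> gives
    \<open>14 \<le> L\<close>.\<close>
  have "wins (4 * k - 2) (6 * k - 2) []"
    using assms by (intro wins_empty_board) auto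
  then have "builder_wins_within (path_graph 3) (path_graph 3) (cycle_graph (4 * k - 2)) (6 * k - 2)"
    by (rule wins_builder_wins_within)
  then show ?thesis
    unfolding online_ramsey_def by (intro Inf_lower) auto
qed

end
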